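(* Let $\mathbb{F}$ be an algebraically closed field and let $m,p,n$ be positive integers with $n\le mp$. Let $(\bar A,\bar B,\bar C)$ be matrices over $\mathbb{F}$ of sizes $n\times n$, $n\times m$, $p\times n$, whose transfer function $\bar C(sI-\bar A)^{-1}\bar B$ has a left coprime factorization $D^{-1}(s)N(s)$ with $\det D(s)=\det(sI-\bar A)$. Let $E:=E_{(\bar A,\bar B,\bar C)}\subset\mathbb{P}^N=\mathbb{P}(\wedge^m\mathbb{F}^{m+p})$ be the associated linear subspace and $\mathbb{F}^N\subset\mathbb{P}^N$ the affine chart, both defined in the context. Then the pole placement map $$\chi_{(\bar A,\bar B,\bar C)}:\ \mathbb{F}^{mp}\longrightarrow\mathbb{F}^n,\qquad K\longmapsto\det(sI-\bar A-\bar BK\bar C)$$ is surjective if and only if $\dim E=N-n-1$ and, for every $y\in\mathbb{F}^N-(E\cap\mathbb{F}^N)$, $$\operatorname{span}(E,y)\cap\operatorname{Grass}(m,\mathbb{F}^{m+p})\ \neq\ E\cap\operatorname{Grass}(m,\mathbb{F}^{m+p}).$$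
   Context: Here $\mathbb{F}^{mp}$ is the space of $m\times p$ matrices $K$ over $\mathbb{F}$ (compensators), and $\mathbb{F}^n$ is identified with the set of monic polynomials $s^n+a_{n-1}s^{n-1}+\cdots+a_0\in\mathbb{F}[s]$ of degree $n$. A left coprime factorization $D^{-1}(s)N(s)=\bar C(sI-\bar A)^{-1}\bar B$ consists of polynomial matrices $D(s)$ ($p\times p$, $\det D\ne 0$) and $N(s)$ ($p\times m$) such that the full size ($p\times p$) minors of $[D(s)\ N(s)]$ have no common non-trivial polynomial factor. Let $N+1=\binom{m+p}{m}$ (the integer $N$ is not to be confused with the matrix $N(s)$), and let $\mathbb{P}^N=\mathbb{P}(\wedge^m\mathbb{F}^{m+p})$ with Plücker coordinates $k=(k_\alpha)$ indexed by the $m$-element subsets $\alpha$ of $\{1,\dots,m+p\}$. $\operatorname{Grass}(m,\mathbb{F}^{m+p})\subset\mathbb{P}^N$ is the Grassmann variety of $m$-dimensional linear subspaces of $\mathbb{F}^{m+p}$ in its Plücker embedding: the row space of an $m\times(m+p)$ matrix $M$ of rank $m$ has coordinates $k_\alpha(M)$, the $m\times m$ minors of $M$ on the columns in $\alpha$. Let $g_\alpha(s)\in\mathbb{F}[s]$ be the (suitably signed) $p\times p$ minors of $[D(s)\ N(s)]$ on the complementary columns, so that for all $m\times(m+p)$ matrices $M$ over $\mathbb{F}$ $$\det\begin{bmatrix}D(s)\ \ N(s)\\ M\end{bmatrix}=\sum_\alpha g_\alpha(s)\,k_\alpha(M).$$ Each $g_\alpha(s)$ has degree at most $n$. Define the linear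 subspace $$E_{(\bar A,\bar B,\bar C)}:=\Big\{k\in\mathbb{P}^N\ \Big|\ \sum_\alpha g_\alpha(s)k_\alpha=0\ \text{ in } \mathbb{F}[s]\Big\}.$$ Let $\bar\alpha$ be the index consisting of the last $m$ columns, so $g_{\bar\alpha}(s)=\det D(s)$ up to sign, which is the unique $g_\alpha$ of degree $n$. The chart $\mathbb{F}^N\subset\mathbb{P}^N$ is the set of points with $k_{\bar\alpha}\neq 0$ (normalized to $k_{\bar\alpha}=1$). $\operatorname{span}(E,y)$ is the smallest projective linear subspace of $\mathbb{P}^N$ containing $E$ and $y$; the empty linear subspace has dimension $-1$. *)

theory Defs
  imports
    "HOL-Library.Function_Algebras"
    "HOL-Computational_Algebra.Computational_Algebra"
    "Jordan_Normal_Form.Char_Poly"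
    "Jordan_Normal_Form.Gauss_Jordan_Elimination"
    "Jordan_Normal_Form.DL_Rank"
    "Jordan_Normal_Form.DL_Submatrix"
begin

section \<open>Pole placement map\<close>

definition monic_polys :: "nat \<Rightarrow> 'a :: field poly set" where
  "monic_polys n = {f. lead_coeff f = 1 \<and> Polynomial.degree f = n}"

text \<open>\<^const>\<open>char_poly\<close> \<open>X\<close> is \<open>det (s I - X)\<close>.\<close>

definition pole_placement ::
  "'a :: field mat \<Rightarrow> 'a mat \<Rightarrow> 'a mat \<Rightarrow> 'a mat \<Rightarrow> 'a poly" where
  "pole_placement A B C K = char_poly (A + B * K * C)"


section \<open>Coprime factorizations of the transfer function\<close>

definition rat_mat :: "'a :: field poly mat \<Rightarrow> 'a poly fract mat" where
  "rat_mat X = map_mat to_fract X"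

definition const_mat :: "'a :: field mat \<Rightarrow> 'a poly fract mat" where
  "const_mat X = rat_mat (map_mat (\<lambda>a. [:a:]) X)"

text \<open>
  Both inverses below are taken over the field of rational functions. They are only applied
  to invertible matrices, where \<^const>\<open>mat_inverse\<close> does not return \<^const>\<open>None\<close>;
  \<^const>\<open>char_poly_matrix\<close> \<open>A\<close> is the polynomial matrix \<open>s I - A\<close>.
\<close>

definition transfer_function ::
  "'a :: field mat \<Rightarrow> 'a mat \<Rightarrow> 'a mat \<Rightarrow> 'a poly fract mat" where
  "transfer_function A B C =
     const_mat C * the (mat_inverse (rat_mat (char_poly_matrix A))) * const_mat B"

definition hconcat :: "'a :: zero mat \<Rightarrow> 'a mat \<Rightarrow> 'a mat" where
  "hconcat D N = four_block_mat D N (0\<^sub>m 0 (dim_col D)) (0\<^sub>m 0 (dim_col N))"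

definition left_coprime :: "nat \<Rightarrow> nat \<Rightarrow> 'a :: field poly mat \<Rightarrow> 'a poly mat \<Rightarrow> bool" where
  "left_coprime m p D N \<longleftrightarrow>
     (\<forall>f. (\<forall>\<beta>. \<beta> \<subseteq> {..<m + p} \<and> card \<beta> = p \<longrightarrow> f dvd det (submatrix (hconcat D N) UNIV \<beta>))
        \<longrightarrow> is_unit f)"

definition left_coprime_factorization ::
  "nat \<Rightarrow> nat \<Rightarrow> 'a :: field mat \<Rightarrow> 'a mat \<Rightarrow> 'a mat \<Rightarrow> 'a poly mat \<Rightarrow> 'a poly mat \<Rightarrow> bool"
where
  "left_coprime_factorization m p A B C D N \<longleftrightarrow>
     D \<in> carrier_mat p p \<and> N \<in> carrier_mat p m \<and> det D \<noteq> 0 \<and>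
     the (mat_inverse (rat_mat D)) * rat_mat N = transfer_function A B C \<and>
     left_coprime m p D N"


section \<open>Projective space of the exterior power\<close>

text \<open>
  Columns are numbered from \<open>0\<close>. The coordinate space of the exterior power consists of the
  functions on sets of columns that vanish off the \<open>m\<close>-element subsets of \<open>{..<m + p}\<close>.
  A projective point is a line through the origin, i.e. a one-dimensional linear subspace, and a
  set of projective points is a set of such lines.
\<close>

definition fscale :: "'a :: field \<Rightarrow> ('i \<Rightarrow> 'a) \<Rightarrow> 'i \<Rightarrow> 'a" where
  "fscale c k = (\<lambda>i. c * k i)"

interpretation fun_vs: vector_space "fscale :: 'a :: field \<Rightarrow> ('i \<Rightarrow> 'a) \<Rightarrow> 'i \<Rightarrow> 'a"
  by unfold_locales (auto simp: fscale_def fun_eq_iff algebra_simps)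

definition plucker_idx :: "nat \<Rightarrow> nat \<Rightarrow> nat set set" where
  "plucker_idx m p = {\<alpha>. \<alpha> \<subseteq> {..<m + p} \<and> card \<alpha> = m}"

definition plucker_space :: "nat \<Rightarrow> nat \<Rightarrow> (nat set \<Rightarrow> 'a :: field) set" where
  "plucker_space m p = {k. \<forall>\<alpha>. \<alpha> \<notin> plucker_idx m p \<longrightarrow> k \<alpha> = 0}"

definition proj_pt :: "('i \<Rightarrow> 'a :: field) \<Rightarrow> ('i \<Rightarrow> 'a) set" where
  "proj_pt k = range (\<lambda>c. fscale c k)"

definition projectivize :: "('i \<Rightarrow> 'a :: field) set \<Rightarrow> ('i \<Rightarrow> 'a) set set" where
  "projectivize W = proj_pt ` (W - {0})"

definition proj_linear :: "nat \<Rightarrow> nat \<Rightarrow> (nat set \<Rightarrow> 'a :: field) set set \<Rightarrow> bool" where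
  "proj_linear m p L \<longleftrightarrow>
     (\<exists>W. fun_vs.subspace W \<and> W \<subseteq> plucker_space m p \<and> L = projectivize W)"

text \<open>
  For \<open>L\<close> the projectivization of \<open>W\<close>, the union of the lines in \<open>L\<close> is \<open>W\<close>,
  except that it is empty if \<open>W\<close> is zero; the vector space dimension is \<open>0\<close> in either case.
\<close>

definition proj_dim :: "('i \<Rightarrow> 'a :: field) set set \<Rightarrow> int" where
  "proj_dim L = int (fun_vs.dim (\<Union>L)) - 1"

definition proj_span ::
  "nat \<Rightarrow> nat \<Rightarrow> (nat set \<Rightarrow> 'a :: field) set set \<Rightarrow> (nat set \<Rightarrow> 'a) set set" where
  "proj_span m p S = \<Inter>{L. proj_linear m p L \<and> S \<subseteq> L}"


section \<open>Grassmann variety, affine chart, and the subspace of a system\<close>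

definition plucker :: "nat \<Rightarrow> nat \<Rightarrow> 'a :: field mat \<Rightarrow> nat set \<Rightarrow> 'a" where
  "plucker m p M = (\<lambda>\<alpha>. if \<alpha> \<in> plucker_idx m p then det (submatrix M UNIV \<alpha>) else 0)"

definition grass :: "nat \<Rightarrow> nat \<Rightarrow> (nat set \<Rightarrow> 'a :: field) set set" where
  "grass m p = {proj_pt (plucker m p M) | M. M \<in> carrier_mat m (m + p) \<and> vec_space.rank m M = m}"

definition chart :: "nat \<Rightarrow> nat \<Rightarrow> (nat set \<Rightarrow> 'a :: field) set set" where
  "chart m p = {proj_pt k | k. k \<in> plucker_space m p \<and> k {p..<m + p} \<noteq> 0}"

text \<open>
  The sign is that of the Laplace expansion of \<open>det (hconcat D N @\<^sub>r M)\<close> along its last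
  \<open>m\<close> rows, the rows of \<open>M\<close>, so that this determinant is the sum of
  \<open>smult (k\<^sub>\<alpha> M) (g\<^sub>\<alpha>)\<close> over all \<open>\<alpha>\<close>, for every constant \<open>m \<times> (m + p)\<close> matrix \<open>M\<close>.
\<close>

definition minor_poly ::
  "nat \<Rightarrow> nat \<Rightarrow> 'a :: field poly mat \<Rightarrow> 'a poly mat \<Rightarrow> nat set \<Rightarrow> 'a poly" where
  "minor_poly m p D N \<alpha> =
     (- 1) ^ (\<Sum>{p..<m + p} + \<Sum>\<alpha>) * det (submatrix (hconcat D N) UNIV ({..<m + p} - \<alpha>))"

definition E_space ::
  "nat \<Rightarrow> nat \<Rightarrow> 'a :: field poly mat \<Rightarrow> 'a poly mat \<Rightarrow> (nat set \<Rightarrow> 'a) set set" where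
  "E_space m p D N =
     projectivize {k \<in> plucker_space m p.
       (\<Sum>\<alpha>\<in>plucker_idx m p. Polynomial.smult (k \<alpha>) (minor_poly m p D N \<alpha>)) = 0}"

end

theory Submission
  imports Defs "Jordan_Normal_Form.DL_Rank_Submatrix"
begin

text \<open>
  Let \<open>\<Phi> k\<close> be the polynomial \<open>\<Sum>\<^sub>\<alpha> k\<^sub>\<alpha> g\<^sub>\<alpha>\<close>, so that \<open>E\<close> is the
  projectivized kernel of the linear map \<open>\<Phi>\<close>. Laplace expansion and Schur complements over the
  field of rational functions give, for \<open>M = [X Y]\<close>,
  \<open>\<Phi> (k(M)) = det [D N; X Y] = det [s I - A, B; X C, Y]\<close>. Since \<open>s\<close> occurs only
  in the first \<open>n\<close> diagonal entries, this has degree at most \<open>n\<close>, with \<open>n\<close>-th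
  coefficient \<open>det Y\<close>; taking the rows of \<open>M\<close> to be unit vectors, every \<open>\<Phi> k\<close> has
  degree at most \<open>n\<close>, with \<open>n\<close>-th coefficient the last coordinate of \<open>k\<close>.
  For \<open>Y = I\<close> it is the pole placement map at \<open>K = X\<close>.

  By rank and nullity the dimension condition says that \<open>\<Phi>\<close> is onto the polynomials of degree at
  most \<open>n\<close>, as it is when all monic ones are values. For \<open>y = [k]\<close> in the chart but not
  in \<open>E\<close>, a point of the Grassmannian in \<open>span(E, y)\<close> but not in \<open>E\<close> is one whose
  image under \<open>\<Phi>\<close> is a non-zero multiple of \<open>\<Phi> k\<close>; its last coordinate is then
  non-zero, so it is the row space of some \<open>[K I]\<close>.
\<close>

section \<open>Determinants with polynomial entries and Laplace expansion\<close>

text \<open>If one of the two bounds is strict, both sides vanish; otherwise this is the product of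
  leading coefficients.\<close>

lemma coeff_mult_degree_bounds:
  fixes f g :: "'a :: comm_semiring_0 poly"
  assumes "Polynomial.degree f \<le> a" "Polynomial.degree g \<le> b"
  shows "coeff (f * g) (a + b) = coeff f a * coeff g b"
proof (cases "Polynomial.degree f = a \<and> Polynomial.degree g = b")
  case True
  then show ?thesis using coeff_mult_degree_sum[of f g] by simp
next
  case False
  then have lt: "Polynomial.degree f < a \<or> Polynomial.degree g < b" using assms by linarith
  then have "Polynomial.degree (f * g) < a + b"
    using degree_mult_le[of f g] assms by linarith
  then show ?thesis using lt by (auto simp: coeff_eq_0)
qed

lemma prod_degree_bounds:
  fixes f :: "'i \<Rightarrow> 'a :: comm_ring_1 poly"
  assumes "finite I" "\<And>i. i \<in> I \<Longrightarrow> Polynomial.degree (f i) \<le> d i"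
  shows "Polynomial.degree (prod f I) \<le> sum d I \<and>
    coeff (prod f I) (sum d I) = (\<Prod>i\<in>I. coeff (f i) (d i))"
  using assms
proof (induction I rule: finite_induct)
  case (insert x I)
  then have "Polynomial.degree (f x) \<le> d x" "Polynomial.degree (prod f I) \<le> sum d I" by auto
  with insert show ?case
    using degree_mult_le[of "f x" "prod f I"] by (simp add: coeff_mult_degree_bounds add_mono order.trans)
qed simp

text \<open>Each Leibniz term takes exactly one factor from every row, so the row bounds add up, and
  the coefficients at the total form the Leibniz expansion of the matrix of row-leading
  coefficients.\<close>

lemma det_row_degree_bounds:
  fixes X :: "'a :: comm_ring_1 poly mat"
  assumes X: "X \<in> carrier_mat k k"
    and deg: "\<And>i j. i < k \<Longrightarrow> j < k \<Longrightarrow> Polynomial.degree (X $$ (i, j)) \<le> d i"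
  shows "Polynomial.degree (det X) \<le> (\<Sum>i<k. d i)"
    and "coeff (det X) (\<Sum>i<k. d i) = det (mat k k (\<lambda>(i, j). coeff (X $$ (i, j)) (d i)))"
proof -
  have sgn: "coeff (signof \<pi> * f) i = signof \<pi> * coeff f i" 
    "Polynomial.degree (signof \<pi> * f) = Polynomial.degree f" for \<pi> i and f :: "'a poly"
    by (auto simp: sign_def)
  have pr: "Polynomial.degree (\<Prod>i = 0..<k. X $$ (i, \<pi> i)) \<le> (\<Sum>i<k. d i)"
    "coeff (\<Prod>i = 0..<k. X $$ (i, \<pi> i)) (\<Sum>i<k. d i) = (\<Prod>i = 0..<k. coeff (X $$ (i, \<pi> i)) (d i))"
    if "\<pi> permutes {0..<k}" for \<pi>
    using prod_degree_bounds[of "{0..<k}" "\<lambda>i. X $$ (i, \<pi> i)" d] deg permutes_in_image[OF that]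
    by (auto simp: lessThan_atLeast0)
  show "Polynomial.degree (det X) \<le> (\<Sum>i<k. d i)"
    unfolding det_def'[OF X] by (rule degree_sum_le) (auto simp: sgn pr finite_permutations)
  have "coeff (det X) (\<Sum>i<k. d i) =
      (\<Sum>\<pi> | \<pi> permutes {0..<k}. signof \<pi> * (\<Prod>i = 0..<k. coeff (X $$ (i, \<pi> i)) (d i)))"
    unfolding det_def'[OF X] coeff_sum by (rule sum.cong) (auto simp: sgn pr)
  also have "\<dots> = det (mat k k (\<lambda>(i, j). coeff (X $$ (i, j)) (d i)))"
    unfolding det_def'[OF mat_carrier]
    by (intro sum.cong arg_cong2[where f = "(*)"] prod.cong) (auto simp: permutes_in_image)
  finally show "coeff (det X) (\<Sum>i<k. d i) = det (mat k k (\<lambda>(i, j). coeff (X $$ (i, j)) (d i)))" .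
qed

section \<open>Column selections and Laplace expansion\<close>

text \<open>\<open>pick S i\<close> is the element of \<open>S\<close> with exactly \<open>i\<close>
  smaller elements in \<open>S\<close>, and a strictly increasing map preserves this count.\<close>

lemma pick_image:
  assumes "finite S" "strict_mono_on S f" "i < card S"
  shows "pick (f ` S) i = f (pick S i)"
proof -
  define x where "x = pick S i"
  have x: "x \<in> S" "card {a \<in> S. a < x} = i"
    using assms(3) by (auto simp: x_def pick_in_set_le card_pick_le)
  have inj: "inj_on f S" using assms(2) by (rule strict_mono_on_imp_inj_on)
  have "{b \<in> f ` S. b < f x} = f ` {a \<in> S. a < x}"
    using assms(2) x(1) by (auto simp: strict_mono_on_less)
  moreover have "inj_on f {a \<in> S. a < x}" using inj by (rule inj_on_subset) auto
  ultimately have "card {b \<in> f ` S. b < f x} = i" using x(2) by (simp add: card_image)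
  then show ?thesis using pick_card_in_set[of "f x" "f ` S"] x(1) by (simp add: x_def)
qed

lemma pick_lessThan:
  assumes "j < k"
  shows "pick {..<k} j = j"
  using pick_reduce_set[of j k UNIV] assms by (simp add: pick_UNIV lessThan_def)

lemma pick_upper:
  assumes "j < m"
  shows "pick {p..<m + p} j = j + p"
proof -
  have "pick ((\<lambda>x. x + p) ` {..<m}) j = pick {..<m} j + p"
    using assms by (intro pick_image) (auto simp: strict_mono_on_def)
  moreover have "(\<lambda>x. x + p) ` {..<m} = {p..<m + p}"
    by (metis add_0 image_add_atLeastLessThan' lessThan_atLeast0)
  ultimately show ?thesis using assms by (simp add: pick_lessThan)
qed

text \<open>As \<open>f\<close> is increasing on \<open>S\<close>, the selected columns keep their
  relative order, so the two submatrices agree entry by entry.\<close>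

lemma submatrix_permute_cols:
  assumes X: "X \<in> carrier_mat r k" and S: "S \<subseteq> {..<k}" and f: "strict_mono_on S f" "f ` S \<subseteq> {..<k}"
    and Y: "Y \<in> carrier_mat r k" "\<And>i j. i < r \<Longrightarrow> j \<in> S \<Longrightarrow> Y $$ (i, f j) = X $$ (i, j)"
  shows "submatrix Y UNIV (f ` S) = submatrix X UNIV S"
proof -
  have fin: "finite S" using S finite_subset by blast
  have c: "{j. j < k \<and> j \<in> f ` S} = f ` S" "{j. j < k \<and> j \<in> S} = S" using S f(2) by auto
  have card: "card (f ` S) = card S"
    using f(1) by (intro card_image strict_mono_on_imp_inj_on)
  show ?thesis
    using X Y c card by (intro eq_matI)
      (auto simp: submatrix_def pick_UNIV pick_image[OF fin f(1)] pick_in_set_le)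
qed

text \<open>
  Keeps the Leibniz terms of \<open>det (P @\<^sub>r M)\<close> in which the rows of \<open>M\<close> use exactly the
  columns \<open>S\<close>.
\<close>

definition row_mask :: "nat \<Rightarrow> nat \<Rightarrow> 'a :: zero mat \<Rightarrow> 'a mat \<Rightarrow> nat set \<Rightarrow> 'a mat" where
  "row_mask m p P M S = mat (m + p) (m + p) (\<lambda>(i, j).
     if i < p then if j \<in> S then 0 else P $$ (i, j) else if j \<in> S then M $$ (i - p, j) else 0)"

text \<open>Groups the Leibniz terms by the set of columns that the last \<open>m\<close> rows use;
  every permutation belongs to exactly one such set.\<close>

lemma det_append_rows_row_mask:
  fixes P M :: "'a :: comm_ring_1 mat"
  assumes P: "P \<in> carrier_mat p (m + p)" and M: "M \<in> carrier_mat m (m + p)"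
  shows "det (P @\<^sub>r M) = (\<Sum>S\<in>plucker_idx m p. det (row_mask m p P M S))"
proof -
  let ?k = "m + p" and ?Z = "P @\<^sub>r M"
  have Z: "?Z \<in> carrier_mat ?k ?k" using P M by (metis add.commute carrier_append_rows)
  have Zi: "?Z $$ (i, j) = (if i < p then P $$ (i, j) else M $$ (i - p, j))" if "i < ?k" "j < ?k" for i j
    using that P M by (auto simp: append_rows_def)
  have fin: "finite (plucker_idx m p)" by (auto simp: plucker_idx_def)
  have mask: "(\<Prod>i = 0..<?k. row_mask m p P M S $$ (i, \<pi> i)) =
      (if S = \<pi> ` {p..<?k} then \<Prod>i = 0..<?k. ?Z $$ (i, \<pi> i) else 0)"
    if \<pi>: "\<pi> permutes {0..<?k}" and S: "S \<in> plucker_idx m p" for \<pi> S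
  proof -
    have im: "\<pi> i < ?k" if "i < ?k" for i using permutes_in_image[OF \<pi>, of i] that by auto
    have inj: "\<pi> i = \<pi> j \<longleftrightarrow> i = j" for i j using permutes_inj[OF \<pi>] by (auto simp: inj_def)
    show ?thesis
    proof (cases "S = \<pi> ` {p..<?k}")
      case True
      have "row_mask m p P M S $$ (i, \<pi> i) = ?Z $$ (i, \<pi> i)" if "i < ?k" for i
        using that im[OF that] by (auto simp: row_mask_def True Zi inj image_iff)
      then show ?thesis using True by (auto intro: prod.cong)
    next
      case False
      have "card (\<pi> ` {p..<?k}) = m" using permutes_inj_on[OF \<pi>] by (simp add: card_image)
      \<comment> \<open>Two different sets of \<open>m\<close> columns: the image has a point
        outside \<open>S\<close>, where the masked row of \<open>M\<close> is zero.\<close>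
      then have "\<not> \<pi> ` {p..<?k} \<subseteq> S"
        using False S card_subset_eq[of S "\<pi> ` {p..<?k}"]
        by (auto simp: plucker_idx_def dest: finite_subset)
      then obtain i where i: "p \<le> i" "i < ?k" "\<pi> i \<notin> S" by (force simp: subset_iff)
      then have "row_mask m p P M S $$ (i, \<pi> i) = 0" using im by (auto simp: row_mask_def)
      then have "(\<Prod>i = 0..<?k. row_mask m p P M S $$ (i, \<pi> i)) = 0"
        using i by (intro prod_zero) auto
      then show ?thesis using False by simp
    qed
  qed
  have img: "\<pi> ` {p..<?k} \<in> plucker_idx m p" if "\<pi> permutes {0..<?k}" for \<pi>
    using permutes_inj_on[OF that] permutes_in_image[OF that]
    by (auto simp: plucker_idx_def card_image)
  have "(\<Sum>S\<in>plucker_idx m p. det (row_mask m p P M S)) =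
      (\<Sum>\<pi> | \<pi> permutes {0..<?k}. \<Sum>S\<in>plucker_idx m p.
        signof \<pi> * (\<Prod>i = 0..<?k. row_mask m p P M S $$ (i, \<pi> i)))"
    by (subst sum.swap) (simp add: det_def row_mask_def)
  also have "\<dots> = (\<Sum>\<pi> | \<pi> permutes {0..<?k}. signof \<pi> * (\<Prod>i = 0..<?k. ?Z $$ (i, \<pi> i)))"
  proof (rule sum.cong[OF refl], clarsimp simp: sum_distrib_left[symmetric])
    fix \<pi> assume \<pi>: "\<pi> permutes {0..<?k}"
    have "(\<Sum>S\<in>plucker_idx m p. \<Prod>i = 0..<?k. row_mask m p P M S $$ (i, \<pi> i)) =
        (\<Prod>i = 0..<?k. ?Z $$ (i, \<pi> i))"
      by (simp add: mask[OF \<pi>] sum.delta[OF fin] img[OF \<pi>] cong: sum.cong)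
    then show "signof \<pi> * (\<Sum>S\<in>plucker_idx m p. \<Prod>i = 0..<?k. row_mask m p P M S $$ (i, \<pi> i)) =
        signof \<pi> * (\<Prod>i = 0..<?k. ?Z $$ (i, \<pi> i))" by simp
  qed
  also have "\<dots> = det ?Z" by (rule det_def'[OF Z, symmetric])
  finally show ?thesis ..
qed

text \<open>Without a gap, \<open>S\<close> is closed under successors below \<open>m + p\<close>,
  so it is a final segment whose length is fixed by its cardinality. The first case is the base case
  of moving \<open>S\<close> to the right, the second allows one more swap.\<close>

lemma plucker_idx_upper_or_gap:
  assumes S: "S \<in> plucker_idx m p"
  obtains "S = {p..<m + p}" | j where "j \<in> S" "Suc j \<notin> S" "Suc j < m + p"
proof (cases "\<exists>j\<in>S. Suc j \<notin> S \<and> Suc j < m + p")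
  case False
  have up: "x + i \<in> S" if "x \<in> S" "x + i < m + p" for x i
    using that(2) by (induction i) (use that(1) False in auto)
  have S': "S \<subseteq> {..<m + p}" "card S = m" "finite S"
    using S by (auto simp: plucker_idx_def dest: finite_subset)
  have "S \<subseteq> {p..<m + p}"
  proof
    fix x assume x: "x \<in> S"
    \<comment> \<open>Comparing cardinalities gives \<open>m + p - x \<le> m\<close>, hence
      \<open>p \<le> x\<close>.\<close>
    have "{x..<m + p} \<subseteq> S" using up[OF x] by (metis atLeastLessThan_iff le_Suc_ex subsetI)
    from card_mono[OF S'(3) this] show "x \<in> {p..<m + p}" using x S' by auto
  qed
  then have "S = {p..<m + p}" using S' card_subset_eq[of "{p..<m + p}" S] by simp
  then show ?thesis using that(1) by blast
qed (use that(2) in blast)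

lemma det_row_mask:
  fixes P M :: "'a :: idom mat"
  assumes "P \<in> carrier_mat p (m + p)" "M \<in> carrier_mat m (m + p)" "S \<in> plucker_idx m p"
  shows "det (row_mask m p P M S) = (-1) ^ (\<Sum>{p..<m + p} + \<Sum>S) *
    det (submatrix P UNIV ({..<m + p} - S)) * det (submatrix M UNIV S)"
  using assms
  \<comment> \<open>Swapping columns \<open>j\<close> and \<open>j + 1\<close>, where \<open>j \<in> S\<close> and \<open>j + 1 \<notin> S\<close>, changes the sign and
    keeps both minors; repeated swaps move \<open>S\<close> to the last \<open>m\<close> columns.\<close>
proof (induction "\<Sum>x\<in>S. m + p - x" arbitrary: P M S rule: less_induct)
  case less
  note P = less.prems(1) and M = less.prems(2)
  let ?k = "m + p"
  have S: "S \<subseteq> {..<?k}" "card S = m" "finite S"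
    using less.prems(3) by (auto simp: plucker_idx_def dest: finite_subset)
  from less.prems(3) show ?case
  proof (cases rule: plucker_idx_upper_or_gap)
    case 1
    have c: "{..<?k} - S = {..<p}" using 1 by auto
    have "{j. j < p \<and> j < ?k} = {..<p}" "{j. p \<le> j \<and> j < ?k} = {p..<?k}" by auto
    then have d: "card {j. j < p \<and> j < ?k} = p" "card {j. p \<le> j \<and> j < ?k} = m"
      "{j. j < ?k \<and> j < p} = {j. j < p \<and> j < ?k}"
      "{j. j < ?k \<and> p \<le> j \<and> j < ?k} = {j. p \<le> j \<and> j < ?k}" by auto
    have "row_mask m p P M S = four_block_mat (submatrix P UNIV ({..<?k} - S)) (0\<^sub>m p m)
        (0\<^sub>m m p) (submatrix M UNIV S)"
      using P M unfolding c unfolding 1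
      by (intro eq_matI) (auto simp: row_mask_def submatrix_def pick_UNIV pick_lessThan pick_upper d)
    also have "det \<dots> = det (submatrix P UNIV ({..<?k} - S)) * det (submatrix M UNIV S)"
      using P M unfolding c unfolding 1 
      by (intro det_four_block_mat_upper_right_zero) (auto simp: submatrix_def d)
    \<comment> \<open>Here both sums in the exponent agree, so it is even.\<close>
    also have "(- 1 :: 'a) ^ (\<Sum>{p..<?k} + \<Sum>S) = 1" unfolding 1 by simp
    ultimately show ?thesis by simp
  next
    case (2 j)
    let ?t = "Transposition.transpose j (Suc j)"
    let ?S = "?t ` S" and ?P = "swapcols j (Suc j) P" and ?M = "swapcols j (Suc j) M"
    have S_eq: "?S = insert (Suc j) (S - {j})" using 2 by (auto simp: Transposition.transpose_def)
    have cS_eq: "{..<?k} - ?S = ?t ` ({..<?k} - S)"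
      using 2 S(1) by (auto simp: S_eq image_iff Transposition.transpose_def split: if_splits)
    \<comment> \<open>The transposition reverses only the order of \<open>j\<close> and
      \<open>Suc j\<close>, and exactly one of them lies in \<open>S\<close>.\<close>
    have mono: "strict_mono_on S ?t" "strict_mono_on ({..<?k} - S) ?t"
      using 2 by (auto simp: strict_mono_on_def Transposition.transpose_def)
    have S': "?S \<in> plucker_idx m p"
    proof -
      have "card ?S = card S" by (simp add: card_image)
      then show ?thesis using 2 S by (auto simp: plucker_idx_def S_eq)
    qed
    have P': "?P \<in> carrier_mat p ?k" and M': "?M \<in> carrier_mat m ?k" using P M by auto
    \<comment> \<open>Replacing \<open>j\<close> by \<open>Suc j\<close> lowers the induction
      measure by one.\<close>
    have "(\<Sum>x\<in>S. ?k - x) = (?k - j) + (\<Sum>x\<in>S - {j}. ?k - x)"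
      using 2 S by (simp add: sum.remove)
    moreover have "(\<Sum>x\<in>?S. ?k - x) = (?k - Suc j) + (\<Sum>x\<in>S - {j}. ?k - x)"
      using 2 S by (simp add: S_eq)
    ultimately have "(\<Sum>x\<in>?S. ?k - x) < (\<Sum>x\<in>S. ?k - x)" using 2 by simp
    note IH = less.hyps[OF this P' M' S']
    have sub: "submatrix ?M UNIV ?S = submatrix M UNIV S"
      using 2 S mono S' M M' by (intro submatrix_permute_cols[of _ m ?k])
        (auto simp: plucker_idx_def Transposition.transpose_def)
    have "submatrix ?P UNIV ({..<?k} - ?S) = submatrix P UNIV ({..<?k} - S)"
      unfolding cS_eq using 2 S mono S' P P' by (intro submatrix_permute_cols[of _ p ?k])
        (auto simp: plucker_idx_def Transposition.transpose_def)
    note sub = sub this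
    \<comment> \<open>The exponent grows by one, which matches the sign change of the determinant
      under the swap.\<close>
    have sum: "\<Sum>?S = Suc (\<Sum>S)"
      using 2 S by (simp add: S_eq sum.remove[of S j])
    have "row_mask m p ?P ?M ?S = swapcols j (Suc j) (row_mask m p P M S)"
      using 2 P M by (intro eq_matI) (auto simp: row_mask_def S_eq)
    then have "det (row_mask m p ?P ?M ?S) = - det (row_mask m p P M S)"
      using 2 by (simp add: det_swapcols[where n = ?k] row_mask_def)
    then show ?thesis using IH by (simp add: sub sum equation_minus_iff)
  qed
qed

lemma det_append_rows_laplace:
  fixes P M :: "'a :: idom mat"
  assumes "P \<in> carrier_mat p (m + p)" "M \<in> carrier_mat m (m + p)"
  shows "det (P @\<^sub>r M) = (\<Sum>S\<in>plucker_idx m p. (-1) ^ (\<Sum>{p..<m + p} + \<Sum>S) *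
    det (submatrix P UNIV ({..<m + p} - S)) * det (submatrix M UNIV S))"
  using assms by (simp add: det_append_rows_row_mask det_row_mask cong: sum.cong)

section \<open>Pluecker coordinates and the realization\<close>

lemma submatrix_map_mat:
  assumes "J \<subseteq> {..<dim_col X}"
  shows "submatrix (map_mat f X) UNIV J = map_mat f (submatrix X UNIV J)"
proof -
  have [simp]: "{j. j < dim_col X \<and> j \<in> J} = J" using assms by auto
  have "pick J j < dim_col X" if "j < card J" for j
    using pick_in_set_le[OF that] assms by auto
  then show ?thesis by (intro eq_matI) (auto simp: submatrix_def pick_UNIV)
qed

lemma hconcat_carrier [simp]:
  "X \<in> carrier_mat r c \<Longrightarrow> Y \<in> carrier_mat r d \<Longrightarrow> hconcat X Y \<in> carrier_mat r (c + d)"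
  by (auto simp: hconcat_def)

lemma hconcat_append_rows_hconcat:
  assumes "X \<in> carrier_mat r c" "Y \<in> carrier_mat r d" "Z \<in> carrier_mat s c" "W \<in> carrier_mat s d"
  shows "hconcat X Y @\<^sub>r hconcat Z W = four_block_mat X Y Z W"
  using assms by (intro eq_matI) (auto simp: append_rows_def hconcat_def)

lemma hconcat_split:
  assumes "M \<in> carrier_mat r (c + d)"
  obtains X Y where "X \<in> carrier_mat r c" "Y \<in> carrier_mat r d" "M = hconcat X Y"
proof
  show "M = hconcat (mat r c (\<lambda>(i, j). M $$ (i, j))) (mat r d (\<lambda>(i, j). M $$ (i, j + c)))"
    using assms by (intro eq_matI) (auto simp: hconcat_def)
qed auto

abbreviation lift_mat :: "'a :: zero mat \<Rightarrow> 'a poly mat" where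
  "lift_mat \<equiv> map_mat (\<lambda>a. [:a:])"

lemma comm_ring_hom_const_poly: "comm_ring_hom (\<lambda>a :: 'a :: comm_ring_1. [:a:])"
  by unfold_locales auto

lemma comm_ring_hom_to_fract: "comm_ring_hom (to_fract :: 'a :: idom \<Rightarrow> 'a fract)"
  by unfold_locales auto

text \<open>The sign in \<open>minor_poly\<close> is that of the Laplace expansion, and the minors
  of the constant rows are constants; this turns \<Phi> at a Pluecker vector into a
  determinant.\<close>

lemma sum_plucker_minor_poly:
  fixes D N :: "'a :: field poly mat"
  assumes D: "D \<in> carrier_mat p p" and N: "N \<in> carrier_mat p m" and M: "M \<in> carrier_mat m (m + p)"
  shows "(\<Sum>\<alpha>\<in>plucker_idx m p. Polynomial.smult (plucker m p M \<alpha>) (minor_poly m p D N \<alpha>)) =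
    det (hconcat D N @\<^sub>r lift_mat M)"
proof -
  interpret comm_ring_hom "\<lambda>a :: 'a. [:a:]" by (rule comm_ring_hom_const_poly)
  have "det (submatrix (lift_mat M) UNIV \<alpha>) = [:plucker m p M \<alpha>:]" if "\<alpha> \<in> plucker_idx m p" for \<alpha>
    using that M by (subst submatrix_map_mat) (auto simp: plucker_def plucker_idx_def)
  moreover have "hconcat D N \<in> carrier_mat p (m + p)" using hconcat_carrier[OF D N] by (simp add: add.commute)
  ultimately show ?thesis using M
    by (simp add: det_append_rows_laplace minor_poly_def mult.commute cong: sum.cong)
qed

section \<open>Schur complements and the state space realization\<close>

text \<open>\<open>Q\<close> stands for \<open>X^-1 * Y\<close>, specified only by
  \<open>X * Q = Y\<close>. Multiplying on the right by the unitriangular \<open>?U\<close> clears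
  the upper right block.\<close>

lemma det_four_block_schur:
  fixes X :: "'a :: idom mat"
  assumes X: "X \<in> carrier_mat r r" and Y: "Y \<in> carrier_mat r c" and Z: "Z \<in> carrier_mat c r"
    and W: "W \<in> carrier_mat c c" and Q: "Q \<in> carrier_mat r c" "X * Q = Y"
  shows "det (four_block_mat X Y Z W) = det X * det (W - Z * Q)"
proof -
  let ?U = "four_block_mat (1\<^sub>m r) (- Q) (0\<^sub>m c r) (1\<^sub>m c)"
  have YQ: "X * (- Q) + Y = 0\<^sub>m r c" using X Y Q by simp
  have WQ: "- (Z * Q) + W = W - Z * Q" using Z W Q by (intro eq_matI) auto
  have "det (four_block_mat X Y Z W) = det (four_block_mat X Y Z W) * det ?U"
    using Q by (subst det_four_block_mat_lower_left_zero[where n = r and m = c]) auto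
  also have "\<dots> = det (four_block_mat X Y Z W * ?U)"
    using X Y Z W Q by (intro det_mult[symmetric, where n = "r + c"]) auto
  also have "four_block_mat X Y Z W * ?U = four_block_mat X (0\<^sub>m r c) Z (W - Z * Q)"
    using X Y Z W Q
    by (simp add: mult_four_block_mat[OF X Y Z W, of "1\<^sub>m r" r "- Q" c "0\<^sub>m c r" "1\<^sub>m c"] YQ WQ)
  also have "det \<dots> = det X * det (W - Z * Q)"
    using X Z W Q by (intro det_four_block_mat_upper_right_zero) auto
  finally show ?thesis .
qed

text \<open>A matrix with non-zero determinant is a unit, so \<open>mat_inverse\<close> returns a
  genuine inverse and \<open>the\<close> is well defined.\<close>

lemma mat_inverse_right:
  fixes X :: "'a :: field mat"
  assumes "X \<in> carrier_mat r r" "det X \<noteq> 0"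
  shows "the (mat_inverse X) \<in> carrier_mat r r" "X * the (mat_inverse X) = 1\<^sub>m r"
proof -
  have "X \<in> Units (ring_mat TYPE('a) r ())" using assms by (rule det_non_zero_imp_unit)
  then obtain R where "mat_inverse X = Some R" using mat_inverse(1)[OF assms(1), where b = "()"] by (cases "mat_inverse X") auto
  then show "the (mat_inverse X) \<in> carrier_mat r r" "X * the (mat_inverse X) = 1\<^sub>m r"
    using mat_inverse(2)[OF assms(1)] by auto
qed

text \<open>Over the rational functions both sides have the same Schur complement
  \<open>Y - X * G\<close>, where \<open>G\<close> is the transfer function, and the same factor in
  front of it since \<open>det D = char_poly A\<close>.\<close>

lemma det_factorization_realization:
  fixes A B C X Y :: "'a :: field mat" and D N :: "'a poly mat"
  assumes A: "A \<in> carrier_mat n n" and B: "B \<in> carrier_mat n m" and C: "C \<in> carrier_mat p n"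
    and fact: "left_coprime_factorization m p A B C D N" and detD: "det D = char_poly A"
    and X: "X \<in> carrier_mat m p" and Y: "Y \<in> carrier_mat m m"
  shows "det (four_block_mat D N (lift_mat X) (lift_mat Y)) =
    det (four_block_mat (char_poly_matrix A) (lift_mat B) (lift_mat (X * C)) (lift_mat Y))"
proof -
  interpret h: comm_ring_hom "to_fract :: 'a poly \<Rightarrow> 'a poly fract" by (rule comm_ring_hom_to_fract)
  interpret l: comm_ring_hom "\<lambda>a :: 'a. [:a:]" by (rule comm_ring_hom_const_poly)
  let ?D = "rat_mat D" and ?N = "rat_mat N" and ?T = "rat_mat (char_poly_matrix A)"
  have D: "D \<in> carrier_mat p p" and N: "N \<in> carrier_mat p m" and D0: "det D \<noteq> 0"
    and tf: "the (mat_inverse ?D) * ?N = transfer_function A B C"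
    using fact by (auto simp: left_coprime_factorization_def)
  have det: "det (rat_mat Z) = to_fract (det Z)" for Z :: "'a poly mat" by (simp add: rat_mat_def)
  have car: "rat_mat Z \<in> carrier_mat r c \<longleftrightarrow> Z \<in> carrier_mat r c" for Z :: "'a poly mat" and r c
    by (simp add: rat_mat_def)
  have ccar: "const_mat Z \<in> carrier_mat r c \<longleftrightarrow> Z \<in> carrier_mat r c" for Z :: "'a mat" and r c
    by (simp add: rat_mat_def const_mat_def)
  have T: "char_poly_matrix A \<in> carrier_mat n n" using A by simp
  let ?R = "the (mat_inverse ?D)" and ?S = "the (mat_inverse ?T)"
  have R: "?R \<in> carrier_mat p p" "?D * ?R = 1\<^sub>m p"
    using D D0 by (intro mat_inverse_right; simp add: det car)+
  have S: "?S \<in> carrier_mat n n" "?T * ?S = 1\<^sub>m n"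
    using T D0 detD by (intro mat_inverse_right; simp add: det car char_poly_def)+
  define G where "G = ?R * ?N"
  have G: "G \<in> carrier_mat p m" "?D * G = ?N"
    using R N D by (auto simp: G_def car assoc_mult_mat[of _ p p _ p _ m, symmetric])
  have SB: "?S * const_mat B \<in> carrier_mat n m" "?T * (?S * const_mat B) = const_mat B"
    using S B T by (auto simp: car ccar assoc_mult_mat[of _ n n _ n _ m, symmetric])
  \<comment> \<open>The factorization enters here: \<open>G\<close> is also
    \<open>C * (s I - A)^-1 * B\<close>.\<close>
  have XCG: "const_mat (X * C) * (?S * const_mat B) = const_mat X * G"
  proof -
    have "const_mat (X * C) = const_mat X * const_mat C"
      using X C by (simp add: const_mat_def rat_mat_def l.mat_hom_mult[OF X C] h.mat_hom_mult[of _ m p _ n])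
    moreover have "G = const_mat C * (?S * const_mat B)"
      using C S B by (simp add: G_def tf transfer_function_def ccar assoc_mult_mat[of _ p n _ n _ m])
    ultimately show ?thesis
      using X C SB by (simp add: ccar assoc_mult_mat[of _ m p _ n _ m])
  qed
  have block: "rat_mat (four_block_mat Z1 Z2 (lift_mat Z3) (lift_mat Z4)) =
      four_block_mat (rat_mat Z1) (rat_mat Z2) (const_mat Z3) (const_mat Z4)"
    if "Z1 \<in> carrier_mat r r" "Z2 \<in> carrier_mat r m" "Z3 \<in> carrier_mat m r" "Z4 \<in> carrier_mat m m"
    for r Z1 Z2 Z3 Z4
    using that by (simp add: rat_mat_def const_mat_def map_four_block_mat[of _ r r _ m _ m])
  have "to_fract (det (four_block_mat D N (lift_mat X) (lift_mat Y))) =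
      det (four_block_mat ?D ?N (const_mat X) (const_mat Y))"
    by (simp add: det[symmetric] block[OF D N X Y])
  also have "\<dots> = det ?D * det (const_mat Y - const_mat X * G)"
    using D N X Y G by (intro det_four_block_schur) (auto simp: car ccar)
  also have "\<dots> = det ?T * det (const_mat Y - const_mat (X * C) * (?S * const_mat B))"
    by (simp add: XCG det detD char_poly_def)
  also have "\<dots> = det (four_block_mat ?T (const_mat B) (const_mat (X * C)) (const_mat Y))"
    using T B C X Y SB by (intro det_four_block_schur[symmetric]) (auto simp: car ccar)
  also have "\<dots> = to_fract (det (four_block_mat (char_poly_matrix A) (lift_mat B) (lift_mat (X * C)) (lift_mat Y)))"
    using block[OF T _ _ Y, of "lift_mat B" "X * C"] B X C by (simp add: det[symmetric] const_mat_def)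
  \<comment> \<open>Injectivity of \<open>to_fract\<close> brings the identity back to
    polynomials.\<close>
  finally show ?thesis by simp
qed

text \<open>The first \<open>n\<close> rows have degree at most 1 and the others are constant. The
  matrix of row-leading coefficients is block triangular with diagonal blocks the identity and
  \<open>Y\<close>.\<close>

lemma realization_det_bounds:
  fixes A B Z Y :: "'a :: field mat"
  assumes A: "A \<in> carrier_mat n n" and B: "B \<in> carrier_mat n m"
    and Z: "Z \<in> carrier_mat m n" and Y: "Y \<in> carrier_mat m m"
  defines "X \<equiv> four_block_mat (char_poly_matrix A) (lift_mat B) (lift_mat Z) (lift_mat Y)"
  shows "Polynomial.degree (det X) \<le> n" "coeff (det X) n = det Y"
proof -
  define d where "d i = (if i < n then 1 else 0 :: nat)" for i
  have d: "(\<Sum>i<n + m. d i) = n"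
  proof -
    have "(\<Sum>i<n + m. d i) = card {i \<in> {..<n + m}. i < n}" by (simp add: d_def sum.If_cases Int_def)
    also have "{i \<in> {..<n + m}. i < n} = {..<n}" by auto
    finally show ?thesis by simp
  qed
  have X: "X \<in> carrier_mat (n + m) (n + m)" using A Y by (simp add: X_def)
  have deg: "Polynomial.degree (X $$ (i, j)) \<le> d i" if "i < n + m" "j < n + m" for i j
    using that A B Z Y by (auto simp: X_def d_def char_poly_matrix_def degree_pCons_eq_if
      intro: order.trans[OF degree_add_le_max])
  have "mat (n + m) (n + m) (\<lambda>(i, j). coeff (X $$ (i, j)) (d i)) = four_block_mat (1\<^sub>m n) (0\<^sub>m n m) Z Y"
    using A B Z Y by (intro eq_matI) (auto simp: X_def d_def char_poly_matrix_def)
  then show "Polynomial.degree (det X) \<le> n" "coeff (det X) n = det Y"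
    using det_row_degree_bounds[OF X deg] Z Y
    by (simp_all add: d det_four_block_mat_upper_right_zero[where n = n and m = m])
qed

text \<open>Subtracting the last block column times \<open>K * C\<close> from the first one clears
  the lower left block and turns \<open>s I - A\<close> into
  \<open>s I - A - B * K * C\<close>.\<close>

lemma realization_det_feedback:
  fixes A B C K :: "'a :: field mat"
  assumes A: "A \<in> carrier_mat n n" and B: "B \<in> carrier_mat n m" and C: "C \<in> carrier_mat p n"
    and K: "K \<in> carrier_mat m p"
  shows "det (four_block_mat (char_poly_matrix A) (lift_mat B) (lift_mat (K * C)) (lift_mat (1\<^sub>m m))) =
    pole_placement A B C K"
proof -
  interpret l: comm_ring_hom "\<lambda>a :: 'a. [:a:]" by (rule comm_ring_hom_const_poly)
  let ?T = "char_poly_matrix A" and ?Z = "lift_mat (K * C)"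
  let ?U = "four_block_mat (1\<^sub>m n) (0\<^sub>m n m) (- ?Z) (1\<^sub>m m)"
  have one: "lift_mat (1\<^sub>m m) = (1\<^sub>m m :: 'a poly mat)" by (intro eq_matI) auto
  have assoc: "B * K * C = B * (K * C)" using B K C by (rule assoc_mult_mat)
  have BKC: "lift_mat B * (- ?Z) = - lift_mat (B * (K * C))"
    using B K C l.mat_hom_mult[of B n m "K * C" n] by simp
  have cpm: "?T + - lift_mat (B * (K * C)) = char_poly_matrix (A + B * (K * C))"
    using A B K C by (intro eq_matI) (auto simp: char_poly_matrix_def)
  have ZZ: "?Z + - ?Z = 0\<^sub>m m n" using K C by (intro eq_matI) auto
  have T: "?T \<in> carrier_mat n n" using A by simp
  have "det (four_block_mat ?T (lift_mat B) ?Z (1\<^sub>m m)) = det (four_block_mat ?T (lift_mat B) ?Z (1\<^sub>m m)) * det ?U"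
    using K C by (subst det_four_block_mat_upper_right_zero[where n = n and m = m]) auto
  also have "\<dots> = det (four_block_mat ?T (lift_mat B) ?Z (1\<^sub>m m) * ?U)"
    using T B K C by (intro det_mult[symmetric, where n = "n + m"]) auto
  also have "four_block_mat ?T (lift_mat B) ?Z (1\<^sub>m m) * ?U =
      four_block_mat (char_poly_matrix (A + B * (K * C))) (lift_mat B) (0\<^sub>m m n) (1\<^sub>m m)"
    using T B K C
    by (simp add: mult_four_block_mat[of _ n n _ m _ m _ "1\<^sub>m n" n "0\<^sub>m n m" m "- ?Z" "1\<^sub>m m"] BKC cpm ZZ)
  also have "det \<dots> = det (char_poly_matrix (A + B * (K * C)))"
    using A B K C by (subst det_four_block_mat_lower_left_zero[where n = n and m = m]) auto
  finally show ?thesis by (simp add: one assoc pole_placement_def char_poly_def)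
qed

section \<open>Pluecker coordinates\<close>

lemma plucker_hconcat_last:
  assumes "X \<in> carrier_mat m p" "Y \<in> carrier_mat m m"
  shows "plucker m p (hconcat X Y) {p..<m + p} = det Y"
proof -
  have "{j. j < p + m \<and> p \<le> j \<and> j < m + p} = {p..<m + p}" by auto
  then have "submatrix (hconcat X Y) UNIV {p..<m + p} = Y"
    using assms by (intro eq_matI) (auto simp: submatrix_def pick_UNIV pick_upper hconcat_def)
  then show ?thesis by (auto simp: plucker_def plucker_idx_def)
qed

text \<open>Selecting columns commutes with multiplication from the left, so all maximal minors are
  scaled by the same factor.\<close>

lemma plucker_mult_left:
  assumes Y: "Y \<in> carrier_mat m m" and M: "M \<in> carrier_mat m (m + p)"
  shows "plucker m p (Y * M) = fscale (det Y) (plucker m p M)"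
proof
  fix \<alpha>
  show "plucker m p (Y * M) \<alpha> = fscale (det Y) (plucker m p M) \<alpha>"
  proof (cases "\<alpha> \<in> plucker_idx m p")
    case True
    then have \<alpha>: "\<alpha> \<subseteq> {..<m + p}" "card \<alpha> = m" by (auto simp: plucker_idx_def)
    then have c: "{j. j < m + p \<and> j \<in> \<alpha>} = \<alpha>" by auto
    have lt: "pick \<alpha> j < m + p" if "j < m" for j using pick_in_set_le[of j \<alpha>] that \<alpha> by auto
    have sub: "submatrix M UNIV \<alpha> \<in> carrier_mat m m"
      using M \<alpha> c by (auto simp: submatrix_def)
    have "submatrix (Y * M) UNIV \<alpha> = Y * submatrix M UNIV \<alpha>"
      using Y M \<alpha> c lt by (intro eq_matI)
        (auto simp: submatrix_def pick_UNIV scalar_prod_def intro!: sum.cong)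
    then show ?thesis using True det_mult[OF Y sub] by (simp add: plucker_def fscale_def)
  qed (simp add: plucker_def fscale_def)
qed

text \<open>Every coordinate vector is a Pluecker vector; statements about the single
  \<open>minor_poly\<close> can therefore be read off from determinants.\<close>

lemma plucker_unit_rows:
  assumes \<alpha>: "\<alpha> \<in> plucker_idx m p"
  shows "plucker m p (mat m (m + p) (\<lambda>(i, j). of_bool (j = pick \<alpha> i))) = (\<lambda>\<beta>. of_bool (\<beta> = \<alpha>))"
    (is "plucker m p ?M = _")
proof
  fix \<beta>
  show "plucker m p ?M \<beta> = of_bool (\<beta> = \<alpha>)"
  proof (cases "\<beta> \<in> plucker_idx m p")
    case True
    let ?s = "submatrix ?M UNIV \<beta>"
    have \<beta>: "\<beta> \<subseteq> {..<m + p}" "card \<beta> = m" "{j. j < m + p \<and> j \<in> \<beta>} = \<beta>" and \<alpha>': "card \<alpha> = m" "finite \<alpha>"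
      using True \<alpha> by (auto simp: plucker_idx_def dest: finite_subset)
    have lt: "pick \<beta> j < m + p" if "j < m" for j using pick_in_set_le[of j \<beta>] that \<beta> by auto
    have s: "?s \<in> carrier_mat m m" "?s $$ (i, j) = of_bool (pick \<beta> j = pick \<alpha> i)" if "i < m" "j < m" for i j
      using that \<beta> lt by (auto simp: submatrix_def pick_UNIV)
    have sc: "?s \<in> carrier_mat m m" using \<beta> by (simp add: submatrix_def)
    show ?thesis
    proof (cases "\<beta> = \<alpha>")
      case True
      have "pick \<alpha> j = pick \<alpha> i \<longleftrightarrow> j = i" if "i < m" "j < m" for i j
        using that \<alpha>' pick_mono_le[of i \<alpha> j] pick_mono_le[of j \<alpha> i] by (metis less_irrefl nat_neq_iff)
      then have "?s = 1\<^sub>m m" using sc s True by (intro eq_matI) auto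
      then show ?thesis using True \<alpha> by (simp add: plucker_def)
    next
      case False
      have "finite \<beta>" using \<beta>(1) finite_subset by blast
      then have "\<not> \<alpha> \<subseteq> \<beta>" using False \<alpha>' \<beta> card_subset_eq[of \<beta> \<alpha>] by auto
      then obtain b where b: "b \<in> \<alpha>" "b \<notin> \<beta>" by blast
      \<comment> \<open>Row \<open>i\<close> of \<open>?M\<close> is the unit vector at column
        \<open>b\<close>; as \<open>b\<close> is not selected by \<beta>, row \<open>i\<close> of
        the minor is zero.\<close>
      define i where "i = card {a \<in> \<alpha>. a < b}"
      have i: "pick \<alpha> i = b" using b by (simp add: i_def pick_card_in_set)
      have "{a \<in> \<alpha>. a < b} \<subset> \<alpha>" using b by auto
      from psubset_card_mono[OF \<alpha>'(2) this] have im: "i < m" using \<alpha>'(1) by (simp add: i_def)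
      have "?s $$ (i, j) = 0" if "j < m" for j
      proof -
        have "pick \<beta> j \<in> \<beta>" using that \<beta>(2) by (simp add: pick_in_set_le)
        then have "pick \<beta> j \<noteq> b" using b(2) by blast
        then show ?thesis using s(2)[OF im that] i by simp
      qed
      then have "(\<Prod>i = 0..<m. ?s $$ (i, \<pi> i)) = 0" if "\<pi> permutes {0..<m}" for \<pi>
        using im permutes_in_image[OF that] by (intro prod_zero bexI[of _ i]) auto
      then have "det ?s = 0" unfolding det_def'[OF sc] by (intro sum.neutral) simp
      then show ?thesis using False \<open>\<beta> \<in> plucker_idx m p\<close> by (simp add: plucker_def)
    qed
  next
    case False
    then show ?thesis using \<alpha> by (auto simp: plucker_def)
  qed
qed

text \<open>For \<open>M = [X Y]\<close> the last coordinate is \<open>det Y\<close>. If it is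
  non-zero, then \<open>M = Y * [K I]\<close> with \<open>K = Y^-1 * X\<close>.\<close>

lemma plucker_eq_scaled_chart:
  fixes M :: "'a :: field mat"
  assumes M: "M \<in> carrier_mat m (m + p)" and nz: "plucker m p M {p..<m + p} \<noteq> 0"
  obtains K where "K \<in> carrier_mat m p"
    "plucker m p M = fscale (plucker m p M {p..<m + p}) (plucker m p (hconcat K (1\<^sub>m m)))"
proof -
  obtain X Y where X: "X \<in> carrier_mat m p" and Y: "Y \<in> carrier_mat m m" and MXY: "M = hconcat X Y"
    using hconcat_split[of M m p m] M by (auto simp: add.commute)
  have det: "plucker m p M {p..<m + p} = det Y" using X Y by (simp add: MXY plucker_hconcat_last)
  let ?R = "the (mat_inverse Y)"
  have R: "?R \<in> carrier_mat m m" "Y * ?R = 1\<^sub>m m"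
    using mat_inverse_right[OF Y] nz det by auto
  have YRX: "Y * (?R * X) = X" using X Y R by (simp add: assoc_mult_mat[of _ m m _ m _ p, symmetric])
  have RX: "?R * X \<in> carrier_mat m p" using X R by simp
  have M': "hconcat (?R * X) (1\<^sub>m m) \<in> carrier_mat m (m + p)"
    using hconcat_carrier[OF RX, of "1\<^sub>m m" m] by (simp add: add.commute)
  have "Y * hconcat (?R * X) (1\<^sub>m m) = hconcat (Y * (?R * X)) Y"
  proof -
    \<comment> \<open>\<open>hconcat\<close> is a block matrix with empty lower blocks, so
      \<open>Y\<close> is padded likewise to apply the block product rule.\<close>
    have "Y * hconcat (?R * X) (1\<^sub>m m) = four_block_mat Y (0\<^sub>m m 0) (0\<^sub>m 0 m) (0\<^sub>m 0 0) * 
      four_block_mat (?R * X) (1\<^sub>m m) (0\<^sub>m 0 p) (0\<^sub>m 0 m)"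
      using X Y R by (intro arg_cong2[where f = "(*)"] eq_matI) (auto simp: hconcat_def)
    also have "\<dots> = hconcat (Y * (?R * X)) Y"
      using X Y R by (subst mult_four_block_mat[where ?nr1.0 = m and ?nr2.0 = 0
        and ?n1.0 = m and ?n2.0 = 0 and ?nc1.0 = p and ?nc2.0 = m])
        (auto simp: hconcat_def)
    finally show ?thesis .
  qed
  then have "plucker m p M = fscale (det Y) (plucker m p (hconcat (?R * X) (1\<^sub>m m)))"
    using plucker_mult_left[OF Y M'] by (simp add: YRX MXY)
  then show ?thesis using that[OF RX] det by simp
qed

section \<open>The linear map \<Phi> and its leading coefficient\<close>

definition minor_comb :: "nat \<Rightarrow> nat \<Rightarrow> 'a :: field poly mat \<Rightarrow> 'a poly mat \<Rightarrow> (nat set \<Rightarrow> 'a) \<Rightarrow> 'a poly" where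
  "minor_comb m p D N k = (\<Sum>\<alpha>\<in>plucker_idx m p. Polynomial.smult (k \<alpha>) (minor_poly m p D N \<alpha>))"

lemma finite_plucker_idx [simp]: "finite (plucker_idx m p)"
  by (auto simp: plucker_idx_def)

lemma minor_comb_add: "minor_comb m p D N (k + l) = minor_comb m p D N k + minor_comb m p D N l"
  by (simp add: minor_comb_def smult_add_left sum.distrib)

lemma minor_comb_fscale: "minor_comb m p D N (fscale c k) = Polynomial.smult c (minor_comb m p D N k)"
  by (simp add: minor_comb_def fscale_def smult_sum2)

lemma plucker_in_space: "plucker m p M \<in> plucker_space m p"
  by (simp add: plucker_def plucker_space_def)

lemma minor_comb_hconcat:
  fixes A B C X Y :: "'a :: field mat"
  assumes "A \<in> carrier_mat n n" "B \<in> carrier_mat n m" "C \<in> carrier_mat p n"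
    and fact: "left_coprime_factorization m p A B C D N" and "det D = char_poly A"
    and X: "X \<in> carrier_mat m p" and Y: "Y \<in> carrier_mat m m"
  shows "minor_comb m p D N (plucker m p (hconcat X Y)) =
    det (four_block_mat (char_poly_matrix A) (lift_mat B) (lift_mat (X * C)) (lift_mat Y))"
proof -
  have DN: "D \<in> carrier_mat p p" "N \<in> carrier_mat p m"
    using fact by (auto simp: left_coprime_factorization_def)
  have XY: "hconcat X Y \<in> carrier_mat m (m + p)" using hconcat_carrier[OF X Y] by (simp add: add.commute)
  have "lift_mat (hconcat X Y) = hconcat (lift_mat X) (lift_mat Y)"
    using X Y by (intro eq_matI) (auto simp: hconcat_def)
  then show ?thesis
    using DN X Y det_factorization_realization[OF assms]
    by (simp add: minor_comb_def sum_plucker_minor_poly[OF DN XY] hconcat_append_rows_hconcat[of _ p p _ m _ m])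
qed

lemma minor_comb_feedback:
  fixes A B C K :: "'a :: field mat"
  assumes "A \<in> carrier_mat n n" "B \<in> carrier_mat n m" "C \<in> carrier_mat p n"
    and "left_coprime_factorization m p A B C D N" "det D = char_poly A"
    and "K \<in> carrier_mat m p"
  shows "minor_comb m p D N (plucker m p (hconcat K (1\<^sub>m m))) = pole_placement A B C K"
  using minor_comb_hconcat[OF assms, of "1\<^sub>m m"] realization_det_feedback[OF assms(1-3,6)] by simp

text \<open>At the unit vectors selected by \<alpha>, the sum \<Phi> reduces to the single minor,
  which is thus a determinant of the realization; its coefficient at \<open>n\<close> is the last
  Pluecker coordinate of those unit vectors.\<close>

lemma minor_poly_bounds:
  fixes A B C :: "'a :: field mat"
  assumes A: "A \<in> carrier_mat n n" and B: "B \<in> carrier_mat n m" and C: "C \<in> carrier_mat p n"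
    and fact: "left_coprime_factorization m p A B C D N" and detD: "det D = char_poly A"
    and \<alpha>: "\<alpha> \<in> plucker_idx m p"
  shows "Polynomial.degree (minor_poly m p D N \<alpha>) \<le> n"
    and "coeff (minor_poly m p D N \<alpha>) n = of_bool (\<alpha> = {p..<m + p})"
proof -
  let ?M = "mat m (m + p) (\<lambda>(i, j). of_bool (j = pick \<alpha> i)) :: 'a mat"
  obtain X Y where X: "X \<in> carrier_mat m p" and Y: "Y \<in> carrier_mat m m" and MXY: "?M = hconcat X Y"
    using hconcat_split[of ?M m p m] by (auto simp: add.commute)
  have "minor_poly m p D N \<alpha> = minor_comb m p D N (plucker m p ?M)"
    unfolding minor_comb_def plucker_unit_rows[OF \<alpha>]
    using \<alpha> by (simp add: of_bool_def if_distrib[where f = "\<lambda>c. Polynomial.smult c _"]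
      sum.delta cong: if_cong)
  also have "\<dots> = det (four_block_mat (char_poly_matrix A) (lift_mat B) (lift_mat (X * C)) (lift_mat Y))"
    unfolding MXY by (rule minor_comb_hconcat[OF A B C fact detD X Y])
  finally have eq: "minor_poly m p D N \<alpha> = \<dots>" .
  have XC: "X * C \<in> carrier_mat m n" using X C by simp
  note bounds = realization_det_bounds[OF A B XC Y]
  show "Polynomial.degree (minor_poly m p D N \<alpha>) \<le> n" using bounds(1) by (simp add: eq)
  have "det Y = plucker m p ?M {p..<m + p}"
    unfolding MXY by (rule plucker_hconcat_last[OF X Y, symmetric])
  also have "\<dots> = of_bool ({p..<m + p} = \<alpha>)" by (simp only: plucker_unit_rows[OF \<alpha>])
  also have "\<dots> = of_bool (\<alpha> = {p..<m + p})" by (rule arg_cong[OF eq_commute])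
  finally show "coeff (minor_poly m p D N \<alpha>) n = of_bool (\<alpha> = {p..<m + p})"
    using bounds(2) by (simp add: eq)
qed

lemma minor_comb_bounds:
  fixes A B C :: "'a :: field mat"
  assumes "A \<in> carrier_mat n n" "B \<in> carrier_mat n m" "C \<in> carrier_mat p n"
    and "left_coprime_factorization m p A B C D N" "det D = char_poly A"
  shows "Polynomial.degree (minor_comb m p D N k) \<le> n"
    and "coeff (minor_comb m p D N k) n = k {p..<m + p}"
proof -
  note bounds = minor_poly_bounds[OF assms]
  show "Polynomial.degree (minor_comb m p D N k) \<le> n"
    unfolding minor_comb_def by (rule degree_sum_le) (auto intro: order.trans[OF degree_smult_le] bounds)
  have "{p..<m + p} \<in> plucker_idx m p" by (auto simp: plucker_idx_def)
  then show "coeff (minor_comb m p D N k) n = k {p..<m + p}"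
    by (simp add: minor_comb_def coeff_sum bounds of_bool_def if_distrib[where f = "\<lambda>c. _ * c"]
      sum.delta cong: if_cong sum.cong)
qed

section \<open>Dimension and projective subspaces\<close>

text \<open>A basis \<open>B\<close> of the kernel in \<open>V\<close> is extended to a basis
  \<open>B'\<close> of \<open>V\<close>; the added vectors are mapped injectively onto a basis of
  the image. The finite set \<open>T\<close> supplies finiteness of \<open>B'\<close>, as the
  ambient space may be infinite-dimensional.\<close>

lemma (in vector_space_pair) dim_kernel_image:
  assumes f: "Vector_Spaces.linear s1 s2 f" and V: "vs1.subspace V" and T: "finite T" "V \<subseteq> vs1.span T"
  shows "vs1.dim V = vs1.dim {v \<in> V. f v = 0} + vs2.dim (f ` V)"
proof -
  let ?W = "{v \<in> V. f v = 0}"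
  interpret f: Vector_Spaces.linear s1 s2 f by (rule f)
  obtain B where B: "B \<subseteq> ?W" "vs1.independent B" "?W \<subseteq> vs1.span B"
    using vs1.maximal_independent_subset by blast
  obtain B' where B': "B \<subseteq> B'" "B' \<subseteq> V" "vs1.independent B'" "V \<subseteq> vs1.span B'"
    using vs1.maximal_independent_subset_extend[of B V] B by blast
  have fin: "finite B'" using vs1.independent_span_bound[OF T(1) B'(3)] B'(2) T(2) by blast
  let ?R = "B' - B"
  have indR: "vs1.independent ?R" using B'(3) vs1.independent_mono by blast
  \<comment> \<open>The coordinates of a common element with respect to \<open>B'\<close> are
    supported in two disjoint sets, so they all vanish.\<close>
  have span0: "vs1.span ?R \<inter> vs1.span B \<subseteq> {0}"
  proof clarify
    fix x assume x: "x \<in> vs1.span ?R" "x \<in> vs1.span B"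
    have "vs1.representation B' x = vs1.representation ?R x" "vs1.representation B' x = vs1.representation B x"
      using x B'(1,3) by (auto intro: vs1.representation_extend)
    then have "vs1.representation B x b = 0" for b
      using vs1.representation_ne_zero[of ?R x b] vs1.representation_ne_zero[of B x b] by auto
    then show "x = 0" using vs1.sum_nonzero_representation_eq[OF B(2) x(2)] by simp
  qed
  have sV: "vs1.span S \<subseteq> V" if "S \<subseteq> V" for S using vs1.span_minimal[OF that V] .
  have inj: "inj_on f (vs1.span ?R)"
  proof (rule inj_onI)
    fix x y assume xy: "x \<in> vs1.span ?R" "y \<in> vs1.span ?R" "f x = f y"
    then have d: "x - y \<in> vs1.span ?R" by (simp add: vs1.span_diff)
    moreover have "x - y \<in> ?W" using d sV[of ?R] B'(2) xy(3) by (auto simp: f.diff)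
    ultimately show "x = y" using span0 B(3) by auto
  qed
  have "vs2.independent (f ` ?R)"
    using indR inj by (rule f.independent_injective_image)
  moreover have "vs2.span (f ` ?R) = vs2.span (f ` V)"
  proof
    show "vs2.span (f ` ?R) \<subseteq> vs2.span (f ` V)" using B'(2) by (intro vs2.span_mono) auto
    have "f ` V \<subseteq> vs2.span (f ` ?R)"
    proof clarify
      fix v assume "v \<in> V"
      then have "v \<in> vs1.span (B \<union> ?R)" using B'(1,4) by (auto simp: Un_absorb1)
      then obtain x y where xy: "x \<in> vs1.span B" "y \<in> vs1.span ?R" "v = x + y"
        unfolding vs1.span_Un by blast
      have "f z = 0" if "z \<in> B" for z using B(1) that by blast
      then have "f x = 0" using xy(1) by (rule f.eq_0_on_span)
      then show "f v \<in> vs2.span (f ` ?R)" using xy by (simp add: f.add f.span_image)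
    qed
    then show "vs2.span (f ` V) \<subseteq> vs2.span (f ` ?R)" by (intro vs2.span_minimal) auto
  qed
  ultimately have "vs2.dim (f ` V) = card (f ` ?R)" by (intro vs2.dim_eq_card)
  also have "\<dots> = card ?R" using inj vs1.span_superset by (intro card_image) (rule inj_on_subset)
  finally have "vs2.dim (f ` V) = card ?R" .
  moreover have "vs1.dim ?W = card B" using vs1.basis_card_eq_dim[OF B(1,3,2)] by simp
  moreover have "vs1.dim V = card B'" using vs1.basis_card_eq_dim[OF B'(2,4,3)] by simp
  moreover have "card B' = card B + card ?R"
    using fin B'(1) by (metis card_Diff_subset card_mono finite_subset le_add_diff_inverse)
  ultimately show ?thesis by simp
qed

text \<open>A basis of \<open>S\<close> extends to an independent subset of \<open>T\<close>
  spanning \<open>T\<close>; being finite and of equal size, it gains no vector.\<close>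

lemma (in vector_space) subspace_eq_if_dim_eq:
  assumes S: "subspace S" "S \<subseteq> T" and T: "finite F" "T \<subseteq> span F" and dim: "dim S = dim T"
  shows "S = T"
proof -
  obtain B where B: "B \<subseteq> S" "independent B" "S \<subseteq> span B"
    using maximal_independent_subset by blast
  obtain B' where B': "B \<subseteq> B'" "B' \<subseteq> T" "independent B'" "T \<subseteq> span B'"
    using maximal_independent_subset_extend[of B T] B S(2) by blast
  have "finite B'" using independent_span_bound[OF T(1) B'(3)] B'(2) T(2) by blast
  moreover have "card B = card B'"
    using basis_card_eq_dim[OF B(1,3,2)] basis_card_eq_dim[OF B'(2,4,3)] dim by simp
  ultimately have "B = B'" using B'(1) card_subset_eq by blast
  then have "T \<subseteq> span B" using B'(4) by simp
  also have "span B \<subseteq> S" using B(1) S(1) by (rule span_minimal)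
  finally show ?thesis using S(2) by blast
qed

text \<open>The indicator functions of the points of \<open>I\<close> form a basis. This serves both
  the Pluecker space and the coefficient sequences of polynomials of bounded degree.\<close>

lemma supported_functions_basis:
  fixes I :: "'i set"
  assumes I: "finite I"
  defines "V \<equiv> {k :: 'i \<Rightarrow> 'a :: field. \<forall>i. i \<notin> I \<longrightarrow> k i = 0}"
  shows "fun_vs.dim V = card I" "\<exists>T. finite T \<and> V \<subseteq> fun_vs.span T"
proof -
  define e :: "'i \<Rightarrow> 'i \<Rightarrow> 'a" where "e i = (\<lambda>j. of_bool (j = i))" for i
  have inj: "inj e" by (auto simp: inj_def e_def fun_eq_iff)
  have sum: "(\<Sum>i\<in>S. fscale (c i) (e i)) j = (if j \<in> S then c j else 0)" if "finite S" for S c j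
    using that by (induction S rule: finite_induct) (auto simp: fscale_def e_def)
  have span: "V \<subseteq> fun_vs.span (e ` I)"
  proof
    fix k assume "k \<in> V"
    then have "k = (\<Sum>i\<in>I. fscale (k i) (e i))" by (auto simp: V_def fun_eq_iff sum[OF I])
    also have "\<dots> \<in> fun_vs.span (e ` I)"
      by (intro fun_vs.span_sum fun_vs.span_scale fun_vs.span_base) auto
    finally show "k \<in> fun_vs.span (e ` I)" .
  qed
  then show "\<exists>T. finite T \<and> V \<subseteq> fun_vs.span T" using I by blast
  have "fun_vs.independent (e ` I)"
  proof (rule fun_vs.independent_if_scalars_zero)
    fix c x assume z: "(\<Sum>x\<in>e ` I. fscale (c x) x) = 0" and x: "x \<in> e ` I"
    from x obtain i where i: "i \<in> I" "x = e i" by auto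
    have "(\<Sum>i\<in>I. fscale (c (e i)) (e i)) = 0"
      using z inj by (simp add: sum.reindex[OF inj_on_subset[OF inj]])
    from fun_cong[OF this, of i] show "c x = 0" using i by (simp add: sum[OF I])
  qed (use I in simp)
  moreover have "e ` I \<subseteq> V" by (auto simp: V_def e_def)
  ultimately show "fun_vs.dim V = card I"
    using span fun_vs.basis_card_eq_dim[of "e ` I" V] card_image[OF inj_on_subset[OF inj], of I] by simp
qed

section \<open>Projective points, subspaces and spans\<close>

lemma self_in_proj_pt: "k \<in> proj_pt k"
  unfolding proj_pt_def by (rule range_eqI[of _ _ 1]) simp

lemma zero_in_proj_pt: "0 \<in> proj_pt k"
  unfolding proj_pt_def by (rule range_eqI[of _ _ 0]) simp

text \<open>Generators of the same line are multiples of each other, so membership can be tested on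
  any representative.\<close>

lemma proj_pt_in_projectivize:
  fixes k :: "'i \<Rightarrow> 'a :: field"
  assumes W: "fun_vs.subspace W"
  shows "proj_pt k \<in> projectivize W \<longleftrightarrow> k \<in> W \<and> k \<noteq> 0"
proof
  assume "proj_pt k \<in> projectivize W"
  then obtain u where u: "u \<in> W" "u \<noteq> 0" "proj_pt k = proj_pt u" by (auto simp: projectivize_def)
  obtain c where "k = fscale c u" using self_in_proj_pt[of k] u(3) by (auto simp: proj_pt_def)
  moreover obtain d where "u = fscale d k" using self_in_proj_pt[of u] u(3) by (auto simp: proj_pt_def)
  ultimately show "k \<in> W \<and> k \<noteq> 0" using u(1,2) fun_vs.subspace_scale[OF W u(1), of c] by auto
qed (auto simp: projectivize_def)

lemma projectivize_mono: "W \<subseteq> W' \<Longrightarrow> projectivize W \<subseteq> projectivize W'"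
  by (auto simp: projectivize_def)

lemma projectivize_subset_iff:
  assumes "fun_vs.subspace W" "fun_vs.subspace W'"
  shows "projectivize W \<subseteq> projectivize W' \<longleftrightarrow> W \<subseteq> W'"
proof
  assume sub: "projectivize W \<subseteq> projectivize W'"
  show "W \<subseteq> W'"
  proof
    fix k assume "k \<in> W"
    then show "k \<in> W'"
      using sub proj_pt_in_projectivize[OF assms(1), of k] proj_pt_in_projectivize[OF assms(2), of k]
        fun_vs.subspace_0[OF assms(2)] by (cases "k = 0") auto
  qed
qed (rule projectivize_mono)

lemma proj_dim_projectivize:
  fixes W :: "('i \<Rightarrow> 'a :: field) set"
  assumes W: "fun_vs.subspace W"
  shows "proj_dim (projectivize W) = int (fun_vs.dim W) - 1"
\<comment> \<open>For the zero subspace the union of lines is empty rather than \<open>{0}\<close>;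
  both have dimension 0, which gives -1.\<close>
proof (cases "W \<subseteq> {0}")
  case True
  then have W0: "W = {0}" using fun_vs.subspace_0[OF W] by auto
  then have "projectivize W = {}" by (simp add: projectivize_def)
  then show ?thesis
    using fun_vs.span_eq_dim[of "{} :: ('i \<Rightarrow> 'a) set" "{0}"] by (simp add: proj_dim_def W0)
next
  case False
  have "\<Union>(projectivize W) = W"
  proof (intro equalityI subsetI)
    fix x assume "x \<in> \<Union>(projectivize W)"
    then show "x \<in> W" using W fun_vs.subspace_scale by (auto simp: projectivize_def proj_pt_def)
  next
    fix x assume x: "x \<in> W"
    obtain u where u: "u \<in> W" "u \<noteq> 0" using False by auto
    \<comment> \<open>The zero vector spans no line of its own but lies on the line through
      \<open>u\<close>.\<close>
    have "x \<in> proj_pt (if x = 0 then u else x)" by (simp add: self_in_proj_pt zero_in_proj_pt)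
    moreover have "(if x = 0 then u else x) \<in> W - {0}" using x u by simp
    ultimately show "x \<in> \<Union>(projectivize W)" unfolding projectivize_def by blast
  qed
  then show ?thesis by (simp add: proj_dim_def)
qed

text \<open>A projective linear subspace containing the given points comes from a vector subspace
  containing \<open>k\<close> and \<open>W\<close>, hence their span; conversely that span is among
  the subspaces being intersected.\<close>

lemma proj_span_insert_projectivize:
  fixes k :: "nat set \<Rightarrow> 'a :: field"
  assumes W: "fun_vs.subspace W" "W \<subseteq> plucker_space m p" and k: "k \<in> plucker_space m p" "k \<noteq> 0"
  shows "proj_span m p (insert (proj_pt k) (projectivize W)) = projectivize (fun_vs.span (insert k W))"
    (is "_ = projectivize ?U")
proof
  have V: "fun_vs.subspace (plucker_space m p :: (nat set \<Rightarrow> 'a) set)"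
    by (auto simp: fun_vs.subspace_def plucker_space_def fscale_def)
  have U: "fun_vs.subspace ?U" by simp
  have sub: "insert k W \<subseteq> ?U" by (rule fun_vs.span_superset)
  have "?U \<subseteq> plucker_space m p" using W k V by (intro fun_vs.span_minimal) auto
  then have "proj_linear m p (projectivize ?U)" using U by (auto simp: proj_linear_def)
  moreover have "insert (proj_pt k) (projectivize W) \<subseteq> projectivize ?U"
    using sub k(2) projectivize_mono[of W ?U] by (auto simp: proj_pt_in_projectivize[OF U])
  ultimately show "proj_span m p (insert (proj_pt k) (projectivize W)) \<subseteq> projectivize ?U"
    by (auto simp: proj_span_def)
  show "projectivize ?U \<subseteq> proj_span m p (insert (proj_pt k) (projectivize W))"
    unfolding proj_span_def
  proof (rule Inter_greatest, clarify del: subsetI)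
    fix L assume "proj_linear m p L" and L: "insert (proj_pt k) (projectivize W) \<subseteq> L"
    then obtain W' where W': "fun_vs.subspace W'" "L = projectivize W'" by (auto simp: proj_linear_def)
    then have "insert k W \<subseteq> W'"
      using L proj_pt_in_projectivize[OF W'(1)] projectivize_subset_iff[OF W(1) W'(1)] by auto
    then show "projectivize ?U \<subseteq> L" using W' by (simp add: fun_vs.span_minimal projectivize_mono)
  qed
qed


section \<open>Pole placement and the Grassmannian\<close>

lemma (in vec_space) rank_le_nr:
  assumes "M \<in> carrier_mat n nc"
  shows "rank M \<le> n"
proof -
  have "set (cols M) \<subseteq> carrier_vec n" using assms cols_dim by blast
  then have "subspace class_ring (span (set (cols M))) V" by (intro span_is_subspace) simp
  from subspace_dim[OF this fin_dim fin_dim_span_cols[OF assms]] show ?thesis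
    by (simp add: rank_def dim_is_n)
qed

text \<open>A non-zero maximal minor bounds the rank from below by \<open>m\<close>, the number of
  rows bounds it from above.\<close>

lemma proj_pt_plucker_in_grass:
  assumes M: "M \<in> carrier_mat m (m + p)" and nz: "plucker m p M \<alpha> \<noteq> 0"
  shows "proj_pt (plucker m p M) \<in> grass m p"
proof -
  have \<alpha>: "\<alpha> \<subseteq> {..<m + p}" "card \<alpha> = m" and det: "det (submatrix M UNIV \<alpha>) \<noteq> 0"
    using nz by (auto simp: plucker_def plucker_idx_def split: if_splits)
  have "{j. j < m + p \<and> j \<in> \<alpha>} = \<alpha>" using \<alpha>(1) by auto
  then have "m \<le> vec_space.rank m M" using vec_space.rank_gt_minor[OF M det] \<alpha>(2) by simp
  then have "vec_space.rank m M = m" using vec_space.rank_le_nr[OF M] by simp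
  then show ?thesis using M by (auto simp: grass_def)
qed

lemma monic_polys_iff: "f \<in> monic_polys n \<longleftrightarrow> Polynomial.degree f \<le> n \<and> coeff f n = 1"
  using le_degree[of f n] by (auto simp: monic_polys_def)

lemma subspace_plucker_space: "fun_vs.subspace (plucker_space m p)"
  by (auto simp: fun_vs.subspace_def plucker_space_def fscale_def)

abbreviation minor_kernel :: "nat \<Rightarrow> nat \<Rightarrow> 'a :: field poly mat \<Rightarrow> 'a poly mat \<Rightarrow> (nat set \<Rightarrow> 'a) set" where
  "minor_kernel m p D N \<equiv> {k \<in> plucker_space m p. minor_comb m p D N k = 0}"

lemma subspace_minor_kernel: "fun_vs.subspace (minor_kernel m p D N)"
  using subspace_plucker_space[of m p] minor_comb_fscale[of m p D N 0 0]
  by (auto simp: fun_vs.subspace_def minor_comb_add minor_comb_fscale)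

lemma E_space_eq: "E_space m p D N = projectivize (minor_kernel m p D N)"
  by (simp add: E_space_def minor_comb_def)

text \<open>By rank and nullity the dimension condition says that the image of \<Phi> has dimension
  \<open>n + 1\<close>, so that it fills the space of polynomials of degree at most
  \<open>n\<close>, which contains it.\<close>

lemma proj_dim_E_space_iff:
  fixes D N :: "'a :: field poly mat"
  assumes deg: "\<And>k. Polynomial.degree (minor_comb m p D N k) \<le> n"
  shows "proj_dim (E_space m p D N) = (int ((m + p) choose m) - 1) - int n - 1 \<longleftrightarrow>
    {q. Polynomial.degree q \<le> n} \<subseteq> minor_comb m p D N ` plucker_space m p"
proof -
  interpret P: vector_space_pair "fscale :: 'a \<Rightarrow> (nat set \<Rightarrow> 'a) \<Rightarrow> _" "fscale :: 'a \<Rightarrow> (nat \<Rightarrow> 'a) \<Rightarrow> _"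
    by unfold_locales
  \<comment> \<open>Polynomials become coefficient sequences, so that the target is also a function
    space with scalar multiplication \<open>fscale\<close>.\<close>
  define f where "f k = coeff (minor_comb m p D N k)" for k
  let ?V = "plucker_space m p :: (nat set \<Rightarrow> 'a) set" and ?T = "{g :: nat \<Rightarrow> 'a. \<forall>i. i \<notin> {..n} \<longrightarrow> g i = 0}"
  have f: "Vector_Spaces.linear fscale fscale f"
    by (simp add: Vector_Spaces.linear_iff f_def minor_comb_add minor_comb_fscale coeff_smult[abs_def] fscale_def[of _ "coeff _"]
      fun_eq_iff fun_vs.vector_space_axioms)
  have "coeff (minor_comb m p D N k) i = 0" if "n < i" for k i
    using deg[of k] that by (intro coeff_eq_0) simp
  then have sub: "f ` ?V \<subseteq> ?T" by (auto simp: f_def)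
  have V: "fun_vs.dim ?V = (m + p) choose m" "\<exists>S. finite S \<and> ?V \<subseteq> fun_vs.span S"
    using supported_functions_basis[of "plucker_idx m p", where ?'a = 'a] n_subsets[of "{..<m + p}" m]
    by (simp_all add: plucker_space_def plucker_idx_def)
  have "{k \<in> ?V. f k = 0} = minor_kernel m p D N"
    by (auto simp: f_def poly_eq_iff fun_eq_iff)
  then have "(m + p) choose m = fun_vs.dim (minor_kernel m p D N) + fun_vs.dim (f ` ?V)"
    using P.dim_kernel_image[OF f subspace_plucker_space, of _ m p] V by auto
  then have "proj_dim (E_space m p D N) = (int ((m + p) choose m) - 1) - int n - 1 \<longleftrightarrow>
      fun_vs.dim (f ` ?V) = Suc n"
    by (auto simp: E_space_eq proj_dim_projectivize[OF subspace_minor_kernel])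
  also have "\<dots> \<longleftrightarrow> f ` ?V = ?T"
  proof -
    have T: "fun_vs.dim ?T = Suc n" "\<exists>S. finite S \<and> ?T \<subseteq> fun_vs.span S"
      using supported_functions_basis[of "{..n}", where ?'a = 'a] by simp_all
    have "fun_vs.subspace (f ` ?V)" by (rule P.linear_subspace_image[OF f subspace_plucker_space])
    then show ?thesis using fun_vs.subspace_eq_if_dim_eq[OF _ sub] T by auto
  qed
  also have "\<dots> \<longleftrightarrow> {q. Polynomial.degree q \<le> n} \<subseteq> minor_comb m p D N ` ?V"
  proof
    assume eq: "f ` ?V = ?T"
    show "{q. Polynomial.degree q \<le> n} \<subseteq> minor_comb m p D N ` ?V"
    proof clarify
      fix q :: "'a poly" assume "Polynomial.degree q \<le> n"
      then have "coeff q \<in> f ` ?V" unfolding eq by (auto simp: coeff_eq_0)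
      then obtain k where "k \<in> ?V" "coeff q = f k" by blast
      then show "q \<in> minor_comb m p D N ` ?V" by (auto simp: f_def coeff_inject)
    qed
  next
    assume onto: "{q. Polynomial.degree q \<le> n} \<subseteq> minor_comb m p D N ` ?V"
    have "g \<in> f ` ?V" if g: "g \<in> ?T" for g
    proof -
      have c: "coeff (Abs_poly g) = g" using g by (intro coeff_Abs_poly[of n]) auto
      then have "Polynomial.degree (Abs_poly g) \<le> n" using g by (intro degree_le) auto
      then obtain k where "k \<in> ?V" "Abs_poly g = minor_comb m p D N k" using onto by blast
      then have "k \<in> ?V" "g = f k" using c by (auto simp: f_def)
      then show ?thesis by blast
    qed
    then have "?T \<subseteq> f ` ?V" by (rule subsetI)
    with sub show "f ` ?V = ?T" by (rule equalityI)
  qed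
  finally show ?thesis .
qed

text \<open>Every polynomial of degree at most \<open>n\<close> is a monic one minus a multiple of
  the monic \<open>s^n\<close>.\<close>

lemma degree_le_subset_if_monic_subset:
  fixes \<Phi> :: "('i \<Rightarrow> 'a :: field) \<Rightarrow> 'a poly"
  assumes V: "fun_vs.subspace V" and add: "\<And>k l. \<Phi> (k + l) = \<Phi> k + \<Phi> l"
    and scale: "\<And>c k. \<Phi> (fscale c k) = Polynomial.smult c (\<Phi> k)"
    and monic: "monic_polys n \<subseteq> \<Phi> ` V"
  shows "{q. Polynomial.degree q \<le> n} \<subseteq> \<Phi> ` V"
proof clarify
  fix q :: "'a poly" assume q: "Polynomial.degree q \<le> n"
  let ?c = "1 - coeff q n"
  have "q + Polynomial.monom ?c n \<in> monic_polys n" "Polynomial.monom 1 n \<in> monic_polys n"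
    using q by (auto simp: monic_polys_iff degree_monom_le intro: degree_add_le)
  then have "q + Polynomial.monom ?c n \<in> \<Phi> ` V" "Polynomial.monom 1 n \<in> \<Phi> ` V" using monic by auto
  then obtain k l where kl: "k \<in> V" "l \<in> V" "q + Polynomial.monom ?c n = \<Phi> k" "Polynomial.monom 1 n = \<Phi> l"
    by (elim imageE)
  have "\<Phi> (k + fscale (- ?c) l) = q"
    by (simp add: add scale kl(3,4)[symmetric] smult_monom add_monom)
  moreover have "k + fscale (- ?c) l \<in> V" using V kl by (intro fun_vs.subspace_add fun_vs.subspace_scale)
  ultimately show "q \<in> \<Phi> ` V" by (metis image_eqI)
qed

theorem theorem2p1:
  fixes m p n :: nat
    and A B C :: "'a :: alg_closed_field mat"
    and D N :: "'a poly mat"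
  assumes "m > 0" and "p > 0" and "n > 0" and "n \<le> m * p"
    and "A \<in> carrier_mat n n" and "B \<in> carrier_mat n m" and "C \<in> carrier_mat p n"
    and "left_coprime_factorization m p A B C D N"
    and "det D = char_poly A"
  shows "pole_placement A B C ` carrier_mat m p = monic_polys n \<longleftrightarrow>
    proj_dim (E_space m p D N) = (int ((m + p) choose m) - 1) - int n - 1 \<and>
    (\<forall>y \<in> chart m p - (E_space m p D N \<inter> chart m p).
       proj_span m p (insert y (E_space m p D N)) \<inter> grass m p
         \<noteq> E_space m p D N \<inter> grass m p)"
proof -
  let ?V = "plucker_space m p :: (nat set \<Rightarrow> 'a) set" and ?W = "minor_kernel m p D N"
    and ?\<Phi> = "minor_comb m p D N" and ?last = "{p..<m + p}"
    and ?l = "\<lambda>K. plucker m p (hconcat K (1\<^sub>m m))"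
  note sys = assms(5-9)
  note bounds = minor_comb_bounds[OF sys] and feedback = minor_comb_feedback[OF sys]
  have W: "fun_vs.subspace ?W" "?W \<subseteq> ?V" using subspace_minor_kernel by auto
  have last: "?l K ?last = 1" if "K \<in> carrier_mat m p" for K
    using that by (simp add: plucker_hconcat_last)
  \<comment> \<open>This inclusion always holds, since the last coordinate of \<open>[K I]\<close>
    is 1; surjectivity is the converse one.\<close>
  have image: "pole_placement A B C ` carrier_mat m p \<subseteq> monic_polys n"
    using bounds feedback last by (auto simp: monic_polys_iff simp flip: feedback)
  have surj_iff: "pole_placement A B C ` carrier_mat m p = monic_polys n \<longleftrightarrow>
      monic_polys n \<subseteq> pole_placement A B C ` carrier_mat m p"
    using image by (simp add: set_eq_subset)
  have notin_E: "proj_pt k \<notin> projectivize ?W \<longleftrightarrow> ?\<Phi> k \<noteq> 0" if "k \<in> ?V" "k \<noteq> 0" for k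
    using that by (simp add: proj_pt_in_projectivize[OF W(1)])
  have span: "proj_span m p (insert (proj_pt k) (projectivize ?W)) = projectivize (fun_vs.span (insert k ?W))"
    if "k \<in> ?V" "k \<noteq> 0" for k using that by (intro proj_span_insert_projectivize W)
  have in_span: "x \<in> fun_vs.span (insert k ?W) \<longleftrightarrow> (\<exists>c. x - fscale c k \<in> ?W)" for x k
    using W(1) by (simp add: fun_vs.span_breakdown_eq fun_vs.span_eq_iff[THEN iffD2])
  show ?thesis unfolding surj_iff E_space_eq[symmetric] proj_dim_E_space_iff[OF bounds(1)]
  proof (unfold E_space_eq, intro iffI conjI ballI)
    assume surj: "monic_polys n \<subseteq> pole_placement A B C ` carrier_mat m p"
    have "pole_placement A B C K \<in> ?\<Phi> ` ?V" if "K \<in> carrier_mat m p" for K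
      unfolding feedback[OF that, symmetric] by (intro imageI plucker_in_space)
    then have "pole_placement A B C ` carrier_mat m p \<subseteq> ?\<Phi> ` ?V" by (rule image_subsetI)
    with surj have "monic_polys n \<subseteq> ?\<Phi> ` ?V" by (rule subset_trans)
    from degree_le_subset_if_monic_subset[OF subspace_plucker_space minor_comb_add minor_comb_fscale this]
    show "{q. Polynomial.degree q \<le> n} \<subseteq> ?\<Phi> ` ?V" .
  next
    fix y
    assume surj: "monic_polys n \<subseteq> pole_placement A B C ` carrier_mat m p"
      and y: "y \<in> chart m p - (projectivize ?W \<inter> chart m p)"
    from y obtain k where k: "y = proj_pt k" "k \<in> ?V" "k ?last \<noteq> 0" by (auto simp: chart_def)
    then have k0: "k \<noteq> 0" by auto
    \<comment> \<open>The coefficient of \<open>?\<Phi> k\<close> at \<open>n\<close> is the last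
      coordinate of \<open>k\<close>, so \<open>?c\<close> makes it monic.\<close>
    let ?c = "inverse (k ?last)"
    have "Polynomial.smult ?c (?\<Phi> k) \<in> monic_polys n"
      using bounds k(3) by (auto simp: monic_polys_iff)
    then have "Polynomial.smult ?c (?\<Phi> k) \<in> pole_placement A B C ` carrier_mat m p" using surj ..
    then obtain K where K: "K \<in> carrier_mat m p" "Polynomial.smult ?c (?\<Phi> k) = pole_placement A B C K"
      by (rule imageE)
    have l: "?l K \<in> ?V" "?l K ?last \<noteq> 0" using plucker_in_space last[OF K(1)] by auto
    then have l0: "?l K \<noteq> 0" by auto
    \<comment> \<open>\<open>?l K\<close> and the rescaled \<open>k\<close> have the same image, so
      they differ by a kernel element and \<open>?l K\<close> lies in the span.\<close>
    have "?\<Phi> (?l K - fscale ?c k) = 0"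
      using minor_comb_add[of m p D N "?l K - fscale ?c k" "fscale ?c k"]
      by (simp add: feedback[OF K(1)] K(2)[symmetric] minor_comb_fscale)
    then have "?l K - fscale ?c k \<in> ?W"
      using l(1) k(2) by (simp add: fun_vs.subspace_diff fun_vs.subspace_scale subspace_plucker_space)
    then have "?l K \<in> fun_vs.span (insert k ?W)" unfolding in_span by blast
    then have "proj_pt (?l K) \<in> proj_span m p (insert y (projectivize ?W))"
      using l0 by (simp add: k(1) span[OF k(2) k0] proj_pt_in_projectivize)
    moreover have "hconcat K (1\<^sub>m m) \<in> carrier_mat m (m + p)"
      using hconcat_carrier[OF K(1), of "1\<^sub>m m" m] by (simp add: add.commute)
    then have "proj_pt (?l K) \<in> grass m p" using l(2) by (rule proj_pt_plucker_in_grass)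
    moreover have "?\<Phi> (?l K) \<noteq> 0" using bounds(2)[of "?l K"] l(2) by auto
    then have "proj_pt (?l K) \<notin> projectivize ?W" using notin_E[OF l(1) l0] by simp
    ultimately show "proj_span m p (insert y (projectivize ?W)) \<inter> grass m p \<noteq>
      projectivize ?W \<inter> grass m p" by blast
  next
    assume *: "{q. Polynomial.degree q \<le> n} \<subseteq> ?\<Phi> ` ?V \<and>
      (\<forall>y\<in>chart m p - (projectivize ?W \<inter> chart m p).
        proj_span m p (insert y (projectivize ?W)) \<inter> grass m p \<noteq> projectivize ?W \<inter> grass m p)"
    then have surj: "{q. Polynomial.degree q \<le> n} \<subseteq> ?\<Phi> ` ?V" by (rule conjunct1)
    show "monic_polys n \<subseteq> pole_placement A B C ` carrier_mat m p"
    proof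
      fix f :: "'a poly"
      assume f: "f \<in> monic_polys n"
      from f surj obtain k where k: "k \<in> ?V" "?\<Phi> k = f" by (auto simp: monic_polys_iff)
      have last_k: "k ?last = 1" using bounds(2)[of k] f k(2) by (simp add: monic_polys_iff)
      then have k0: "k \<noteq> 0" by auto
      have "f \<noteq> 0" using f by (auto simp: monic_polys_iff)
      then have notin: "proj_pt k \<notin> projectivize ?W" using notin_E[OF k(1) k0] k(2) by simp
      have chart: "proj_pt k \<in> chart m p" using k(1) last_k by (force simp: chart_def)
      let ?U = "fun_vs.span (insert k ?W)"
      have "proj_pt k \<in> chart m p - (projectivize ?W \<inter> chart m p)" using notin chart by blast
      from bspec[OF conjunct2[OF *] this]
      have "projectivize ?U \<inter> grass m p \<noteq> projectivize ?W \<inter> grass m p"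
        by (simp only: span[OF k(1) k0] not_False_eq_True)
      \<comment> \<open>E lies in the span, so the two intersections can differ only by a point of
        the span outside E.\<close>
      moreover have "projectivize ?W \<subseteq> projectivize ?U"
        using fun_vs.span_superset[of "insert k ?W"] by (intro projectivize_mono) auto
      ultimately obtain M where M: "M \<in> carrier_mat m (m + p)"
        and MU: "proj_pt (plucker m p M) \<in> projectivize ?U" "proj_pt (plucker m p M) \<notin> projectivize ?W"
        by (auto simp: grass_def)
      have M0: "plucker m p M \<noteq> 0" and "plucker m p M \<in> ?U"
        using MU(1) by (simp_all add: proj_pt_in_projectivize)
      then obtain c where c: "plucker m p M - fscale c k \<in> ?W" unfolding in_span by blast
      have \<Phi>M: "?\<Phi> (plucker m p M) = Polynomial.smult c f"
        using minor_comb_add[of m p D N "plucker m p M - fscale c k" "fscale c k"] c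
        by (simp add: minor_comb_fscale k(2))
      have "?\<Phi> (plucker m p M) \<noteq> 0" using MU(2) notin_E[OF plucker_in_space M0] by simp
      \<comment> \<open>With \<open>c = 0\<close> the point would lie in E.\<close>
      then have c0: "c \<noteq> 0" using \<Phi>M by auto
      \<comment> \<open>Comparison of coefficients at \<open>n\<close>, \<open>f\<close> being
        monic; the point therefore lies in the chart and is the row space of some
        \<open>[K I]\<close>.\<close>
      have last_M: "plucker m p M ?last = c"
        using bounds(2)[of "plucker m p M"] f by (simp add: \<Phi>M monic_polys_iff)
      obtain K where K: "K \<in> carrier_mat m p" "plucker m p M = fscale c (?l K)"
        using plucker_eq_scaled_chart[OF M] last_M c0 by metis
      have "Polynomial.smult c f = Polynomial.smult c (pole_placement A B C K)"
        by (simp add: \<Phi>M[symmetric] K(2) minor_comb_fscale feedback[OF K(1)])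
      then have "f = pole_placement A B C K" using c0 by (simp add: smult_cancel)
      then show "f \<in> pole_placement A B C ` carrier_mat m p" using K(1) by (rule image_eqI)
    qed
  qed
qed

end
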